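(* Consider the fractional order system of order $\nu$, $0<\nu<2$, with transfer function $G(s)=C(s^\nu I-A)^{-1}B+D$. Given a prescribed $L_\infty$ performance bound $\delta>0$, the bound $$\|G(s)\|_{L_\infty}=\sup_{\omega}\sigma_{\max}(G(\mathrm{j}\omega))<\delta,\qquad \omega\in\Omega_M\triangleq\{\omega\in\mathbb{R}^+:\omega_1\le\omega\le\omega_2\},$$ holds if and only if there exist $U,V\in\mathcal{H}_n$, $V>0$, such that $$\begin{bmatrix}\mathrm{Sym}(X)-A^TVA-\omega_1^\nu\omega_2^\nu V & Y^* & C^T\\ Y & -\delta I-B^TVB & D^T\\ C & D & -\delta I\end{bmatrix}<0,$$ where $X\triangleq A^T(e^{\mathrm{j}\varphi}U+\omega_cV)$, $Y\triangleq-B^TVA+B^T(e^{\mathrm{j}\varphi}U+\omega_cV)$ and $\omega_c=\mathrm{j}^\nu\dfrac{\omega_1^\nu+\omega_2^\nu}{2}$.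
   Context: The fractional order system is $D^\nu x(t)=Ax(t)+Bu(t)$, $y(t)=Cx(t)+Du(t)$, with $x(t)\in\mathbb{R}^n$, $u(t)\in\mathbb{R}^{n_u}$, $y(t)\in\mathbb{R}^{n_y}$, $A,B,C,D$ constant real matrices, $D^\nu$ the fractional differentiation operator of order $\nu$, and the system relaxed at $t=0$; its transfer function matrix is $G$. Here $\mathrm{j}$ is the imaginary unit, $\varphi=\frac{\pi}{2}(\nu-1)$, $\mathbb{R}^+=\{x\in\mathbb{R}:x\ge0\}$, $0\le\omega_1\le\omega_2$, $\mathcal{H}_n$ is the set of $n\times n$ Hermitian matrices, $>0$ and $<0$ denote positive and negative definiteness, $\mathrm{Sym}(M)=M+M^*$, and $\sigma_{\max}$ is the maximum singular value. Powers are taken with the principal argument, so $\mathrm{j}^\nu=e^{\mathrm{j}\pi\nu/2}$ and $(\mathrm{j}\omega)^\nu=e^{\mathrm{j}\pi\nu/2}\omega^\nu$ with $\omega^\nu\in\mathbb{R}^+$ for $\omega\ge0$. In the claim the supremum is over $\omega\in\Omega_M$. *)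

theory Defs
  imports "HOL-Analysis.Analysis"
begin

abbreviation cmat :: "real^'n^'m \<Rightarrow> complex^'n^'m"
  where "cmat M \<equiv> map_matrix complex_of_real M"

definition scale_mat :: "complex \<Rightarrow> complex^'n^'m \<Rightarrow> complex^'n^'m"  (infixr "*\<^sub>m" 75)
  where "c *\<^sub>m M = map_matrix (\<lambda>z. c * z) M"

definition ctranspose :: "complex^'n^'m \<Rightarrow> complex^'m^'n"
  where "ctranspose M = (\<chi> i j. cnj (M $ j $ i))"

definition Sym :: "complex^'n^'n \<Rightarrow> complex^'n^'n"
  where "Sym M = M + ctranspose M"

definition hermitian :: "complex^'n^'n \<Rightarrow> bool"
  where "hermitian M \<longleftrightarrow> ctranspose M = M"

text \<open>The value \<open>x\<^sup>* M x\<close>; it is real when \<open>M\<close> is Hermitian, so that taking the real part below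
  loses nothing.\<close>

definition quad_form :: "complex^'n^'n \<Rightarrow> complex^'n \<Rightarrow> complex"
  where "quad_form M x = (\<Sum>i\<in>UNIV. cnj (x $ i) * (M *v x) $ i)"

definition pos_definite :: "complex^'n^'n \<Rightarrow> bool"
  where "pos_definite M \<longleftrightarrow> hermitian M \<and> (\<forall>x. x \<noteq> 0 \<longrightarrow> Re (quad_form M x) > 0)"

definition neg_definite :: "complex^'n^'n \<Rightarrow> bool"
  where "neg_definite M \<longleftrightarrow> hermitian M \<and> (\<forall>x. x \<noteq> 0 \<longrightarrow> Re (quad_form M x) < 0)"

text \<open>Square roots of the eigenvalues of \<open>M\<^sup>* M\<close>. For a matrix with more columns than rows this
  set may contain an additional \<open>0\<close>, which does not affect the maximum.\<close>

definition singular_values :: "complex^'n^'m \<Rightarrow> real set"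
  where "singular_values M =
    {\<sigma>. \<sigma> \<ge> 0 \<and> (\<exists>v. v \<noteq> 0 \<and> (ctranspose M ** M) *v v = complex_of_real (\<sigma>\<^sup>2) *s v)}"

definition sigma_max :: "complex^'n^'m \<Rightarrow> real"
  where "sigma_max M = Max (singular_values M)"

text \<open>Here \<open>mat c\<close> is the scalar matrix \<open>c I\<close>, and \<open>powr\<close> on the complex numbers uses the principal
  logarithm, with \<open>0 powr a = 0\<close>. The value of \<open>transfer\<close> is meaningful only where
  \<open>s\<^sup>\<nu> I - A\<close> is invertible.\<close>

definition pencil :: "real \<Rightarrow> real^'n^'n \<Rightarrow> complex \<Rightarrow> complex^'n^'n"
  where "pencil \<nu> A s = mat (s powr complex_of_real \<nu>) - cmat A"

definition transfer ::
    "real \<Rightarrow> real^'n^'n \<Rightarrow> real^'u^'n \<Rightarrow> real^'n^'y \<Rightarrow> real^'u^'y \<Rightarrow> complex \<Rightarrow> complex^'u^'y"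
  where "transfer \<nu> A B C D s = cmat C ** matrix_inv (pencil \<nu> A s) ** cmat B + cmat D"

definition freq_band :: "real \<Rightarrow> real \<Rightarrow> real set"
  where "freq_band \<omega>\<^sub>1 \<omega>\<^sub>2 = {\<omega>. 0 \<le> \<omega> \<and> \<omega>\<^sub>1 \<le> \<omega> \<and> \<omega> \<le> \<omega>\<^sub>2}"

definition Linf_norm :: "real set \<Rightarrow> (complex \<Rightarrow> complex^'u^'y) \<Rightarrow> ereal"
  where "Linf_norm \<Omega> G = (SUP \<omega>\<in>\<Omega>. ereal (sigma_max (G (\<i> * complex_of_real \<omega>))))"

text \<open>The block matrix with rows \<open>[P Q R]\<close>, \<open>[S T E]\<close>, \<open>[F H K]\<close>.\<close>

definition block3 ::
    "'a^'n^'k \<Rightarrow> 'a^'u^'k \<Rightarrow> 'a^'y^'k \<Rightarrow>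
     'a^'n^'l \<Rightarrow> 'a^'u^'l \<Rightarrow> 'a^'y^'l \<Rightarrow>
     'a^'n^'m \<Rightarrow> 'a^'u^'m \<Rightarrow> 'a^'y^'m \<Rightarrow> 'a^('n + 'u + 'y)^('k + 'l + 'm)"
  where "block3 P Q R S T E F H K =
    (\<chi> i j. case i of
       Inl a \<Rightarrow> (case j of Inl b \<Rightarrow> P $ a $ b | Inr (Inl b) \<Rightarrow> Q $ a $ b | Inr (Inr b) \<Rightarrow> R $ a $ b)
     | Inr (Inl a) \<Rightarrow>
         (case j of Inl b \<Rightarrow> S $ a $ b | Inr (Inl b) \<Rightarrow> T $ a $ b | Inr (Inr b) \<Rightarrow> E $ a $ b)
     | Inr (Inr a) \<Rightarrow>
         (case j of Inl b \<Rightarrow> F $ a $ b | Inr (Inl b) \<Rightarrow> H $ a $ b | Inr (Inr b) \<Rightarrow> K $ a $ b))"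

end

theory Submission
  imports Defs
begin

text \<open>Write \<open>z = A x + B u\<close> and rotate it to \<open>\<zeta> = j\<^sup>-\<^sup>\<nu> z\<close>, so that the frequency curve becomes
  \<open>\<zeta> = r x\<close> with real \<open>r\<close> between \<open>a = \<omega>\<^sub>1\<^sup>\<nu>\<close> and \<open>b = \<omega>\<^sub>2\<^sup>\<nu>\<close>. After a Schur complement the matrix
  inequality says that a quadratic form in \<open>(x, u)\<close>, linear in \<open>U\<close> and \<open>V\<close>, is negative; on the curve
  its \<open>U\<close>-part vanishes and its \<open>V\<close>-part is \<open>(r - a)(b - r) x\<^sup>*V x\<close>, which gives sufficiency.

  For necessity, separate the convex hull of the moments of the unit vectors from the dual cone of the
  multipliers. If they met, there would be a finite family \<open>(x\<^sub>k, u\<^sub>k)\<close> with Hermitian \<open>Z X\<^sup>*\<close> and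
  \<open>(Z - a X)(b X - Z)\<^sup>*\<close> nonnegative. The nonnegative symmetric relation spanned by the pairs
  \<open>((b X - Z)\<^sup>* v, (Z - a X)\<^sup>* v)\<close> has a self-adjoint extension, and an eigenbasis of it mixes the
  family orthogonally into one whose members all lie on the curve; there the performance form is
  negative, a contradiction.\<close>

section \<open>Symmetric operators and orthonormal bases\<close>

text \<open>The maximum \<open>c\<close> of the form \<open>f x \<bullet> x\<close> over the compact
  unit sphere of \<open>S\<close> makes \<open>c I - f\<close> positive semidefinite on
  \<open>S\<close>. A positive semidefinite form that vanishes at \<open>x\<close> has
  \<open>x\<close> in its kernel.\<close>

lemma symmetric_max_eigenvector:
  fixes f :: "'a::euclidean_space \<Rightarrow> 'a"
  assumes lin: "linear f" and sub: "subspace S" and inv: "f ` S \<subseteq> S" and nz: "S \<noteq> {0}"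
    and sym: "\<And>x y. x \<in> S \<Longrightarrow> y \<in> S \<Longrightarrow> f x \<bullet> y = x \<bullet> f y"
  obtains x c where "x \<in> S" "norm x = 1" "f x = c *\<^sub>R x"
    "\<And>y. y \<in> S \<Longrightarrow> f y \<bullet> y \<le> c * (y \<bullet> y)"
proof -
  let ?K = "S \<inter> sphere 0 1"
  have "compact ?K"
    by (rule closed_Int_compact[OF closed_subspace[OF sub] compact_sphere])
  moreover have "?K \<noteq> {}"
  proof -
    obtain v where "v \<in> S" "v \<noteq> 0" using nz subspace_0[OF sub] by blast
    then have "(1 / norm v) *\<^sub>R v \<in> ?K" by (auto simp: subspace_scale[OF sub])
    then show ?thesis by blast
  qed
  moreover have "continuous_on ?K (\<lambda>x. f x \<bullet> x)"
    using linear_continuous_on[OF linear_conv_bounded_linear[THEN iffD1, OF lin]]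
    by (intro continuous_on_inner continuous_on_id)
  ultimately obtain x where x: "x \<in> ?K" "\<And>y. y \<in> ?K \<Longrightarrow> f y \<bullet> y \<le> f x \<bullet> x"
    using continuous_attains_sup[of ?K "\<lambda>x. f x \<bullet> x"] by metis
  define c where "c = f x \<bullet> x"
  have le: "f y \<bullet> y \<le> c * (y \<bullet> y)" if "y \<in> S" for y
  proof (cases "y = 0")
    case False
    have "f ((1 / norm y) *\<^sub>R y) \<bullet> ((1 / norm y) *\<^sub>R y) \<le> c"
      unfolding c_def using False that by (intro x) (auto simp: subspace_scale[OF sub])
    then have "(f y \<bullet> y) / (norm y)\<^sup>2 \<le> c"
      by (simp add: linear_cmul[OF lin] power2_eq_square)
    then show ?thesis
      using False by (simp add: power2_norm_eq_inner divide_le_eq)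
  qed (simp add: linear_0[OF lin])
  define g where "g y = c *\<^sub>R y - f y" for y
  have linG: "linear g" unfolding g_def
    using lin by (intro linear_compose_sub linear_compose_scale_right linear_ident)
  have gx: "g x \<in> S"
    using x(1) inv unfolding g_def by (auto intro!: subspace_diff[OF sub] subspace_scale[OF sub])
  have symG: "g u \<bullet> v = u \<bullet> g v" if "u \<in> S" "v \<in> S" for u v
    using sym[OF that] by (simp add: g_def inner_diff_left inner_diff_right)
  have posG: "0 \<le> g u \<bullet> u" if "u \<in> S" for u
    using le[OF that] by (simp add: g_def inner_diff_left)
  have gxx: "g x \<bullet> x = 0"
    using x(1) by (simp add: g_def inner_diff_left c_def power2_norm_eq_inner[symmetric])
  have "g x \<bullet> g x = 0"
  proof (rule ccontr)
    assume "g x \<bullet> g x \<noteq> 0"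
    then have p: "0 < g x \<bullet> g x" by (simp add: order_less_le)
    define s where "s = g (g x) \<bullet> g x"
    \<comment> \<open>Moving from \<open>x\<close> along \<open>- g x\<close> changes the form by a
      quadratic in \<open>t\<close> with slope \<open>- 2 * (g x \<bullet> g x)\<close> at 0, so it
      would turn negative for small positive \<open>t\<close>.\<close>
    have "0 \<le> g (x - t *\<^sub>R g x) \<bullet> (x - t *\<^sub>R g x)" for t
      using x(1) gx by (intro posG subspace_diff[OF sub] subspace_scale[OF sub]) auto
    moreover have "g (g x) \<bullet> x = g x \<bullet> g x"
      using symG[of "g x" x] gx x(1) by simp
    ultimately have *: "0 \<le> - 2 * t * (g x \<bullet> g x) + t * t * s" for t
      using gxx
      by (simp add: linear_diff[OF linG] linear_cmul[OF linG] inner_diff_left inner_diff_right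
          s_def algebra_simps)
    have s: "0 \<le> s" unfolding s_def by (rule posG[OF gx])
    \<comment> \<open>The quadratic is smallest at \<open>(g x \<bullet> g x) / s\<close>; the added
      1 covers \<open>s = 0\<close> and still leaves a negative value.\<close>
    define t where "t = (g x \<bullet> g x) / (s + 1)"
    have t: "0 < t" using p s by (simp add: t_def)
    have "0 \<le> t * (- 2 * (g x \<bullet> g x) + t * s)" using *[of t] by (simp add: algebra_simps)
    then have "2 * (g x \<bullet> g x) \<le> t * s" using t by (simp add: zero_le_mult_iff)
    moreover have "t * s \<le> t * (s + 1)" using t by simp
    moreover have "t * (s + 1) = g x \<bullet> g x" using s by (simp add: t_def)
    ultimately show False using p by linarith
  qed
  then have "f x = c *\<^sub>R x" by (simp add: g_def)
  with x(1) le show ?thesis by (intro that[of x c]) auto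
qed

text \<open>Induction on the dimension: split off one eigenvector; by symmetry its orthogonal
  complement in \<open>S\<close> is again invariant.\<close>

lemma symmetric_orthonormal_eigenbasis:
  fixes f :: "'a::euclidean_space \<Rightarrow> 'a"
  assumes lin: "linear f"
    and "subspace S" "f ` S \<subseteq> S" "\<And>x y. x \<in> S \<Longrightarrow> y \<in> S \<Longrightarrow> f x \<bullet> y = x \<bullet> f y"
  shows "\<exists>B. finite B \<and> pairwise orthogonal B \<and> span B = S \<and> (\<forall>q\<in>B. norm q = 1 \<and> (\<exists>c. f q = c *\<^sub>R q))"
  using assms(2-)
proof (induction "dim S" arbitrary: S rule: less_induct)
  case less
  note sub = less.prems(1) and inv = less.prems(2) and sym = less.prems(3)
  show ?case
  proof (cases "S = {0}")
    case True
    then show ?thesis by (intro exI[of _ "{}"]) auto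
  next
    case False
    obtain x c where x: "x \<in> S" "norm x = 1" "f x = c *\<^sub>R x"
      using symmetric_max_eigenvector[OF lin sub inv False sym] by metis
    define T where "T = S \<inter> {y. x \<bullet> y = 0}"
    have subT: "subspace T"
      unfolding T_def by (intro subspace_inter sub subspace_hyperplane)
    have "x \<notin> T" using x(2) by (auto simp: T_def)
    then have "T \<subset> S" using x(1) unfolding T_def by blast
    then have "dim T < dim S"
      by (metis dim_psubset span_eq_iff sub subT)
    moreover have "f ` T \<subseteq> T"
      using inv x sym[OF x(1)] by (fastforce simp: T_def)
    moreover have "\<And>u v. u \<in> T \<Longrightarrow> v \<in> T \<Longrightarrow> f u \<bullet> v = u \<bullet> f v"
      using sym by (auto simp: T_def)
    ultimately obtain B where B: "finite B" "pairwise orthogonal B" "span B = T"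
      "\<forall>q\<in>B. norm q = 1 \<and> (\<exists>c. f q = c *\<^sub>R q)"
      using less.hyps[OF _ subT] by blast
    have BT: "B \<subseteq> T" using B(3) span_superset by blast
    have "pairwise orthogonal (insert x B)"
      using B(2) BT by (auto simp: pairwise_insert T_def orthogonal_def inner_commute)
    moreover have "span (insert x B) = S"
    proof
      show "span (insert x B) \<subseteq> S"
        using BT x(1) by (intro span_minimal sub) (auto simp: T_def)
      show "S \<subseteq> span (insert x B)"
      proof
        fix y assume y: "y \<in> S"
        have "y - (x \<bullet> y) *\<^sub>R x \<in> T"
          using x y by (auto simp: T_def inner_diff_right power2_norm_eq_inner[symmetric]
              intro!: subspace_diff[OF sub] subspace_scale[OF sub])
        then show "y \<in> span (insert x B)"
          unfolding span_insert B(3) by blast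
      qed
    qed
    ultimately show ?thesis
      using B(1,4) x by (intro exI[of _ "insert x B"]) auto
  qed
qed

section \<open>Orthonormal expansions and sums of squared norms\<close>

lemma orthonormal_expansion:
  fixes x :: "'a::euclidean_space"
  assumes fin: "finite B" and orth: "pairwise orthogonal B" and "\<And>q. q \<in> B \<Longrightarrow> norm q = 1"
    and x: "x \<in> span B"
  shows "(\<Sum>q\<in>B. (x \<bullet> q) *\<^sub>R q) = x"
proof -
  define y where "y = x - (\<Sum>q\<in>B. (x \<bullet> q) *\<^sub>R q)"
  have "y \<in> span B"
    unfolding y_def by (intro span_diff x span_sum span_scale span_base)
  moreover have "orthogonal y q" if q: "q \<in> B" for q
  proof -
    have "(\<Sum>r\<in>B. (x \<bullet> r) *\<^sub>R r) \<bullet> q = (\<Sum>r\<in>B. if r = q then x \<bullet> q else 0)"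
      unfolding inner_sum_left
      using assms(3)[OF q] orth q
      by (intro sum.cong) (auto simp: pairwise_def orthogonal_def norm_eq_1)
    then show ?thesis using q fin by (simp add: y_def orthogonal_def inner_diff_left)
  qed
  ultimately have "orthogonal y y" by (metis orthogonal_to_span)
  then show ?thesis by (simp add: y_def orthogonal_self)
qed

lemma orthonormal_parseval:
  fixes x :: "'a::euclidean_space"
  assumes "finite B" "pairwise orthogonal B" "span B = UNIV" "\<And>q. q \<in> B \<Longrightarrow> norm q = 1"
  shows "(\<Sum>q\<in>B. (x \<bullet> q)\<^sup>2) = (norm x)\<^sup>2"
proof -
  have e: "(\<Sum>q\<in>B. (x \<bullet> q) *\<^sub>R q) = x"
    using assms by (intro orthonormal_expansion) auto
  have "(norm x)\<^sup>2 = x \<bullet> (\<Sum>q\<in>B. (x \<bullet> q) *\<^sub>R q)"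
    by (simp add: e power2_norm_eq_inner)
  then show ?thesis by (simp add: inner_sum_right power2_eq_square)
qed

text \<open>Both sides are the squared Hilbert-Schmidt norm of \<open>f\<close>: expand in
  \<open>Basis\<close>, swap the sums, and apply Parseval to the adjoint. This is why mixing a
  family orthogonally preserves its total performance.\<close>

lemma sum_norm_orthonormal_invariant:
  fixes f :: "'a::euclidean_space \<Rightarrow> 'b::euclidean_space"
  assumes lin: "linear f"
    and B: "finite B" "pairwise orthogonal B" "span B = UNIV" "\<And>q. q \<in> B \<Longrightarrow> norm q = 1"
  shows "(\<Sum>q\<in>B. (norm (f q))\<^sup>2) = (\<Sum>q\<in>Basis. (norm (f q))\<^sup>2)"
proof -
  have *: "(\<Sum>q\<in>B. (norm (f q))\<^sup>2) = (\<Sum>c\<in>Basis. (norm (adjoint f c))\<^sup>2)"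
    if B: "finite B" "pairwise orthogonal B" "span B = UNIV" "\<And>q. q \<in> B \<Longrightarrow> norm q = 1" for B
  proof -
    have "(\<Sum>q\<in>B. (norm (f q))\<^sup>2) = (\<Sum>q\<in>B. \<Sum>c\<in>Basis. (f q \<bullet> c)\<^sup>2)"
      unfolding power2_norm_eq_inner
      by (simp add: power2_eq_square flip: euclidean_inner)
    also have "\<dots> = (\<Sum>c\<in>Basis. \<Sum>q\<in>B. (f q \<bullet> c)\<^sup>2)" by (rule sum.swap)
    also have "\<dots> = (\<Sum>c\<in>Basis. \<Sum>q\<in>B. (adjoint f c \<bullet> q)\<^sup>2)"
      by (simp add: adjoint_clauses[OF lin] inner_commute)
    also have "\<dots> = (\<Sum>c\<in>Basis. (norm (adjoint f c))\<^sup>2)"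
      by (simp add: orthonormal_parseval[OF B])
    finally show ?thesis .
  qed
  have "(\<Sum>q\<in>Basis. (norm (f q))\<^sup>2) = (\<Sum>c\<in>Basis. (norm (adjoint f c))\<^sup>2)"
    by (rule *) (auto simp: pairwise_def orthogonal_def inner_Basis)
  with *[OF B] show ?thesis by simp
qed

text \<open>The pairs formed by the adjoints of \<open>F\<close> and \<open>E\<close> at a common
  \<open>v\<close> are a symmetric nonnegative relation. Compressing it to the range of the adjoint
  of \<open>F\<close> gives a self-adjoint operator \<open>M\<close> with \<open>F M = E P\<close>.
  An eigenvector of \<open>M\<close> in that range gives \<open>E q = c *\<^sub>R F q\<close>, and
  the orthogonal complement of the range is the kernel of \<open>F\<close>.\<close>

lemma orthonormal_basis_of_nonneg_relation:
  fixes E F :: "'a::euclidean_space \<Rightarrow> 'b::euclidean_space"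
  assumes linE: "linear E" and linF: "linear F"
    and sym: "\<And>v w. F (adjoint E v) \<bullet> w = v \<bullet> F (adjoint E w)"
    and nonneg: "\<And>v. 0 \<le> F (adjoint E v) \<bullet> v"
  obtains B where "finite B" "pairwise orthogonal B" "span B = UNIV" "\<And>q. q \<in> B \<Longrightarrow> norm q = 1"
    "\<And>q. q \<in> B \<Longrightarrow> F q = 0 \<or> (\<exists>c\<ge>0. E q = c *\<^sub>R F q)"
proof -
  let ?E = "adjoint E" and ?F = "adjoint F"
  have linE': "linear ?E" and linF': "linear ?F"
    using linE linF by (auto intro: adjoint_linear)
  have subR: "subspace (range ?F)"
    using linF' by (metis linear_subspace_image subspace_UNIV)
  \<comment> \<open>\<open>P\<close> is the orthogonal projection onto the range of
    \<open>?F\<close>, built from an orthonormal basis of that range.\<close>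
  obtain P where linP: "linear P" and Psym: "\<And>x y. P x \<bullet> y = x \<bullet> P y"
    and Pid: "\<And>v. P (?F v) = ?F v" and Pran: "\<And>x. P x \<in> range ?F"
  proof -
    obtain R where R: "R \<subseteq> range ?F" "pairwise orthogonal R" "\<And>x. x \<in> R \<Longrightarrow> norm x = 1"
      "independent R" "span R = range ?F"
      using orthonormal_basis_subspace[OF subR] by metis
    have fin: "finite R" using R(4) by (rule independent_imp_finite)
    show ?thesis
    proof (rule that[of "\<lambda>x. \<Sum>q\<in>R. (x \<bullet> q) *\<^sub>R q"])
      show "linear (\<lambda>x. \<Sum>q\<in>R. (x \<bullet> q) *\<^sub>R q)"
        by (intro linearI)
          (simp_all add: inner_add_left scaleR_add_left sum.distrib scaleR_sum_right)
      show "(\<Sum>q\<in>R. (x \<bullet> q) *\<^sub>R q) \<bullet> y = x \<bullet> (\<Sum>q\<in>R. (y \<bullet> q) *\<^sub>R q)" for x y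
        by (simp add: inner_sum_left inner_sum_right inner_commute mult.commute)
      show "(\<Sum>q\<in>R. (?F v \<bullet> q) *\<^sub>R q) = ?F v" for v
        using R fin by (intro orthonormal_expansion) auto
      show "(\<Sum>q\<in>R. (x \<bullet> q) *\<^sub>R q) \<in> range ?F" for x
        unfolding R(5)[symmetric] by (intro span_sum span_scale span_base)
    qed
  qed
  have PP: "P (P x) = P x" for x using Pran[of x] Pid by auto
  have FP: "F (P x) = F x" for x
  proof -
    have "F (P x) \<bullet> v = F x \<bullet> v" for v
      by (metis Pid Psym adjoint_works[OF linF])
    then show ?thesis by (metis vector_eq_rdot)
  qed
  \<comment> \<open>\<open>G\<close> picks a linear preimage under \<open>?F\<close>; the value of
    \<open>M\<close> on the range of \<open>?F\<close> turns out not to depend on this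
    choice.\<close>
  obtain G where linG: "linear G" and G: "\<And>v. ?F (G (?F v)) = ?F v"
    using linear_exists_right_inverse_on[OF linF', of UNIV] by auto
  define M where "M y = P (?E (G (P y)))" for y
  have linM: "linear M"
    unfolding M_def using linear_compose[OF linP linG, THEN linear_compose, OF linE', THEN linear_compose, OF linP]
    by (simp add: o_def)
  have MF: "M (?F v) = P (?E v)" for v
  proof -
    \<comment> \<open>Well-definedness of the compressed relation: if \<open>?F u = 0\<close>, then
      \<open>sym\<close> makes \<open>?E u\<close> orthogonal to the whole range of
      \<open>?F\<close>.\<close>
    have "P (?E u) = 0" if "?F u = 0" for u
    proof -
      have *: "P (?E u) \<bullet> P (?E u) = ?E u \<bullet> P (?E u)"
        by (metis PP Psym)
      obtain w where w: "P (?E u) = ?F w" using Pran[of "?E u"] by auto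
      have "?E u \<bullet> ?F w = F (?E u) \<bullet> w" by (simp add: adjoint_works[OF linF])
      also have "\<dots> = u \<bullet> F (?E w)" by (rule sym)
      also have "\<dots> = ?F u \<bullet> ?E w" by (simp add: adjoint_clauses[OF linF])
      also have "\<dots> = 0" by (simp add: that)
      finally have "?E u \<bullet> P (?E u) = 0" by (simp add: w)
      with * show ?thesis by simp
    qed
    from this[of "G (?F v) - v"] show ?thesis
      unfolding M_def Pid
      by (simp add: G linear_diff[OF linF'] linear_diff[OF linE'] linear_diff[OF linP])
  qed
  have MFF: "M (?F v) \<bullet> ?F w = F (?E v) \<bullet> w" for v w
    by (metis MF Pid Psym adjoint_works[OF linF])
  have MP: "M (P x) = M x" and PM: "P (M x) = M x" for x
    by (simp_all add: M_def PP)
  have Mxy: "M x \<bullet> y = M (P x) \<bullet> P y" for x y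
    by (metis MP PM Psym)
  have Msym: "M x \<bullet> y = x \<bullet> M y" for x y
  proof -
    obtain v w where "P x = ?F v" "P y = ?F w" using Pran by (metis imageE)
    then show ?thesis
      using Mxy[of x y] Mxy[of y x] by (metis MFF sym inner_commute)
  qed
  have Mpos: "0 \<le> M x \<bullet> x" for x
  proof -
    obtain v where "P x = ?F v" using Pran by (metis imageE)
    then show ?thesis using Mxy[of x x] nonneg by (simp add: MFF)
  qed
  \<comment> \<open>This is the adjoint of \<open>MF\<close>, since \<open>M\<close> and
    \<open>P\<close> are self-adjoint.\<close>
  have FM: "F (M x) = E (P x)" for x
  proof -
    have "F (M x) \<bullet> w = E (P x) \<bullet> w" for w
    proof -
      have "F (M x) \<bullet> w = x \<bullet> M (?F w)" by (metis Msym adjoint_works[OF linF])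
      also have "\<dots> = E (P x) \<bullet> w" by (metis MF Psym adjoint_works[OF linE])
      finally show ?thesis .
    qed
    then show ?thesis by (metis vector_eq_rdot)
  qed
  \<comment> \<open>The shift by the complementary projection separates the zero eigenvectors of \<open>M\<close> lying in the
    range of \<open>P\<close> from those in its kernel.\<close>
  define N where "N x = M x - (x - P x)" for x
  have linN: "linear N"
    unfolding N_def by (intro linear_compose_sub linM linP linear_ident)
  have Nsym: "N x \<bullet> y = x \<bullet> N y" for x y
    by (simp add: N_def inner_diff_left inner_diff_right Msym Psym)
  obtain B where B: "finite B" "pairwise orthogonal B" "span B = UNIV"
    "\<forall>q\<in>B. norm q = 1 \<and> (\<exists>c. N q = c *\<^sub>R q)"
    using symmetric_orthonormal_eigenbasis[OF linN subspace_UNIV] Nsym by auto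
  have "F q = 0 \<or> (\<exists>c\<ge>0. E q = c *\<^sub>R F q)" if q: "q \<in> B" for q
  proof -
    obtain c where c: "N q = c *\<^sub>R q" using B(4) q by auto
    have 1: "M q = c *\<^sub>R P q"
      using arg_cong[OF c, of P]
      by (simp add: N_def linear_diff[OF linP] linear_cmul[OF linP] PM PP)
    have 2: "(c + 1) *\<^sub>R (q - P q) = 0"
      using c unfolding N_def 1 by (simp add: algebra_simps)
    have Mqq: "M q \<bullet> q = c * (P q \<bullet> P q)"
      unfolding 1 by (metis PP Psym inner_scaleR_left)
    show ?thesis
    proof (cases "P q = 0")
      case True
      then show ?thesis using FP[of q] linear_0[OF linF] by simp
    next
      case False
      then have pos: "P q \<bullet> P q > 0" by simp
      then have "c \<ge> 0" using Mpos[of q] unfolding Mqq by (metis linorder_not_le zero_le_mult_iff)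
      \<comment> \<open>A nonnegative \<open>c\<close> excludes the eigenvalue -1 of
        \<open>N\<close>, so \<open>q\<close> lies in the range of \<open>P\<close>.\<close>
      moreover have "P q = q" using 2 \<open>c \<ge> 0\<close> by auto
      moreover have "E (P q) = c *\<^sub>R F q"
        using FM[of q] unfolding 1 by (simp add: linear_cmul[OF linF] FP)
      ultimately show ?thesis by auto
    qed
  qed
  with B that show ?thesis by blast
qed

text \<open>Caratheodory bounds the number of points, and padding with weight 0 lets a fixed finite
  type index them. The mixing coefficients can then be vectors over that type.\<close>

lemma convex_hull_indexed:
  fixes x :: "'a::euclidean_space"
  assumes x: "x \<in> convex hull S" and card: "DIM('a) + 1 \<le> CARD('k::finite)"
  obtains p :: "'k::finite \<Rightarrow> real" and v where "\<And>k. 0 \<le> p k" "\<And>k. v k \<in> S" "sum p UNIV = 1"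
    "(\<Sum>k\<in>UNIV. p k *\<^sub>R v k) = x"
proof -
  obtain T where T: "finite T" "T \<subseteq> S" "card T \<le> DIM('a) + 1" "x \<in> convex hull T"
    using x unfolding caratheodory[of S] by auto
  obtain u where u: "\<And>y. y \<in> T \<Longrightarrow> 0 \<le> u y" "sum u T = 1" "(\<Sum>y\<in>T. u y *\<^sub>R y) = x"
    using T(4) unfolding convex_hull_finite[OF T(1)] by auto
  obtain s where s: "s \<in> S" using u(2) T(2) by force
  obtain h :: "'a \<Rightarrow> 'k" where h: "inj_on h T"
    using card_le_inj[OF T(1) finite_class.finite_UNIV] T(3) card by (metis le_trans)
  define g where "g = inv_into T h"
  have gh: "g (h y) = y" if "y \<in> T" for y using h that by (simp add: g_def)
  define p where "p k = (if k \<in> h ` T then u (g k) else 0)" for k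
  define v where "v k = (if k \<in> h ` T then g k else s)" for k
  have *: "(\<Sum>k\<in>UNIV. f k) = (\<Sum>y\<in>T. f (h y))" if "\<And>k. k \<notin> h ` T \<Longrightarrow> f k = 0" for f :: "'k \<Rightarrow> 'c::comm_monoid_add"
  proof -
    have "(\<Sum>k\<in>UNIV. f k) = (\<Sum>k\<in>h ` T. f k)"
      by (rule sum.mono_neutral_right) (auto simp: that)
    then show ?thesis by (simp add: sum.reindex[OF h])
  qed
  show ?thesis
  proof (rule that[of p v])
    show "0 \<le> p k" for k using u(1) gh by (auto simp: p_def)
    show "v k \<in> S" for k using s T(2) gh by (auto simp: v_def)
    show "sum p UNIV = 1"
      by (subst *) (use u(2) gh in \<open>auto simp: p_def cong: sum.cong\<close>)
    show "(\<Sum>k\<in>UNIV. p k *\<^sub>R v k) = x"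
      by (subst *) (use u(3) gh in \<open>auto simp: p_def v_def cong: sum.cong\<close>)
  qed
qed

section \<open>Complex matrices as real operators\<close>

text \<open>The inner product of \<open>complex^'n\<close> as a real Euclidean space is the real
  part of the Hermitian one, so the conjugate transpose is the real adjoint. The real spectral
  results above thereby reach complex matrices.\<close>

lemma inner_ctranspose: "(M *v x) \<bullet> y = x \<bullet> (ctranspose M *v y)"
proof -
  have "(M *v x) \<bullet> y = (\<Sum>i\<in>UNIV. \<Sum>j\<in>UNIV. (M $ i $ j * x $ j) \<bullet> y $ i)"
    by (simp add: inner_vec_def matrix_vector_mult_def inner_sum_left)
  also have "\<dots> = (\<Sum>j\<in>UNIV. \<Sum>i\<in>UNIV. (M $ i $ j * x $ j) \<bullet> y $ i)"
    by (rule sum.swap)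
  also have "\<dots> = (\<Sum>j\<in>UNIV. \<Sum>i\<in>UNIV. x $ j \<bullet> (cnj (M $ i $ j) * y $ i))"
    by (intro sum.cong refl) (simp add: inner_complex_def algebra_simps)
  also have "\<dots> = x \<bullet> (ctranspose M *v y)"
    by (simp add: inner_vec_def matrix_vector_mult_def inner_sum_right ctranspose_def)
  finally show ?thesis .
qed

lemma ctranspose_ctranspose [simp]: "ctranspose (ctranspose M) = M"
  by (simp add: ctranspose_def vec_eq_iff)

lemma ctranspose_add [simp]: "ctranspose (M + N) = ctranspose M + ctranspose N"
  by (simp add: ctranspose_def vec_eq_iff)

lemma ctranspose_diff [simp]: "ctranspose (M - N) = ctranspose M - ctranspose N"
  by (simp add: ctranspose_def vec_eq_iff)

lemma ctranspose_minus [simp]: "ctranspose (- M) = - ctranspose M"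
  by (simp add: ctranspose_def vec_eq_iff)

lemma ctranspose_scaleR [simp]: "ctranspose (c *\<^sub>R M) = c *\<^sub>R ctranspose M"
  by (simp add: ctranspose_def vec_eq_iff)

lemma ctranspose_scale [simp]: "ctranspose (c *\<^sub>m M) = cnj c *\<^sub>m ctranspose M"
  by (simp add: ctranspose_def scale_mat_def vec_eq_iff)

lemma ctranspose_mult [simp]: "ctranspose (M ** N) = ctranspose N ** ctranspose M"
  by (simp add: ctranspose_def matrix_matrix_mult_def vec_eq_iff mult.commute)

lemma ctranspose_mat [simp]: "ctranspose (mat c) = mat (cnj c)"
  by (simp add: ctranspose_def mat_def vec_eq_iff)

lemma ctranspose_cmat [simp]: "ctranspose (cmat M) = cmat (transpose M)"
  by (simp add: ctranspose_def transpose_def vec_eq_iff)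

lemma hermitian_inner: "hermitian M \<Longrightarrow> (M *v x) \<bullet> y = x \<bullet> (M *v y)"
  by (simp add: inner_ctranspose hermitian_def)

lemma scale_mat_vector [simp]: "(c *\<^sub>m M) *v x = c *s (M *v x)"
  by (simp add: scale_mat_def matrix_vector_mult_def vec_eq_iff sum_distrib_left mult.assoc)

lemma mat_vector [simp]: "mat c *v x = c *s (x :: complex^'n)"
  by (simp add: mat_def matrix_vector_mult_def vec_eq_iff if_distrib if_distribR cong: if_cong)

lemma uminus_matrix_vector [simp]: "(- M) *v x = - (M *v (x :: complex^'n))"
  using matrix_vector_mult_diff_rdistrib[of 0 M x] by simp

lemma of_real_vector_smult: "complex_of_real c *s x = c *\<^sub>R (x :: complex^'n)"
  by (simp add: vec_eq_iff) (simp add: scaleR_conv_of_real)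

lemma inner_vector_smult: "x \<bullet> (c *s y) = (cnj c *s x) \<bullet> (y :: complex^'n)"
  unfolding inner_vec_def by (intro sum.cong refl) (simp add: inner_complex_def algebra_simps)

lemma matrix_vector_smult_complex: "M *v (c *s x) = c *s (M *v (x :: complex^'n))"
  by (simp add: matrix_vector_mult_def vec_eq_iff sum_distrib_left mult.left_commute)

lemma norm_vector_smult: "norm (c *s (x :: complex^'n)) = cmod c * norm x"
  by (simp add: norm_vec_def norm_mult L2_set_right_distrib)

lemma Re_quad_form: "Re (quad_form M x) = x \<bullet> (M *v x)"
  by (simp add: quad_form_def inner_vec_def inner_complex_def)

section \<open>Rank-one matrices, Hermitian parts and column families\<close>

definition outer :: "complex^'m \<Rightarrow> complex^'n \<Rightarrow> complex^'n^'m"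
  where "outer x y = (\<chi> i j. x $ i * cnj (y $ j))"

text \<open>Pairing with rank-one matrices makes a quadratic form in vectors linear in its matrix,
  which is what separation by hyperplanes requires.\<close>

lemma inner_outer: "M \<bullet> outer x y = x \<bullet> (M *v y)"
proof -
  have "M \<bullet> outer x y = (\<Sum>i\<in>UNIV. \<Sum>j\<in>UNIV. x $ i \<bullet> (M $ i $ j * y $ j))"
    unfolding inner_vec_def
    by (intro sum.cong refl) (simp add: outer_def inner_complex_def algebra_simps)
  also have "\<dots> = x \<bullet> (M *v y)"
    by (simp add: inner_vec_def matrix_vector_mult_def inner_sum_right)
  finally show ?thesis .
qed

lemma ctranspose_outer [simp]: "ctranspose (outer x y) = outer y x"
  by (simp add: ctranspose_def outer_def vec_eq_iff mult.commute)

lemma outer_linear: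
  "outer (x + x') y = outer x y + outer x' y" "outer x (y + y') = outer x y + outer x y'"
  "outer (x - x') y = outer x y - outer x' y" "outer x (y - y') = outer x y - outer x y'"
  "outer (r *\<^sub>R x) y = r *\<^sub>R outer x y" "outer x (r *\<^sub>R y) = r *\<^sub>R outer x y"
  by (simp_all add: outer_def vec_eq_iff algebra_simps)

lemma inner_ctranspose_mat: "ctranspose M \<bullet> ctranspose N = M \<bullet> N"
proof -
  have "ctranspose M \<bullet> ctranspose N = (\<Sum>i\<in>UNIV. \<Sum>j\<in>UNIV. M $ j $ i \<bullet> N $ j $ i)"
    by (simp add: inner_vec_def ctranspose_def inner_complex_def)
  also have "\<dots> = M \<bullet> N"
    unfolding inner_vec_def by (rule sum.swap)
  finally show ?thesis .
qed

definition herm_part :: "complex^'n^'n \<Rightarrow> complex^'n^'n"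
  where "herm_part M = (1/2) *\<^sub>R (M + ctranspose M)"

lemma hermitian_herm_part: "hermitian (herm_part M)"
  by (simp add: hermitian_def herm_part_def add.commute)

text \<open>Skew-Hermitian matrices are orthogonal to Hermitian ones, so a separating functional can
  be replaced by a Hermitian one without changing it on the moments.\<close>

lemma inner_herm_part: "hermitian N \<Longrightarrow> herm_part M \<bullet> N = M \<bullet> N"
  using inner_ctranspose_mat[of M N] by (simp add: hermitian_def herm_part_def inner_add_left)

text \<open>The matrix with columns \<open>f k\<close>, acting on a coefficient vector; its adjoint
  is the conjugate transpose.\<close>

definition lincomb :: "('k::finite \<Rightarrow> complex^'n) \<Rightarrow> complex^'k \<Rightarrow> complex^'n"
  where "lincomb f a = (\<Sum>k\<in>UNIV. a $ k *s f k)"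

lemma linear_lincomb: "linear (lincomb f)"
  by (intro linearI)
    (simp_all add: lincomb_def vec_eq_iff sum.distrib scaleR_sum_right distrib_right)

lemma adjoint_lincomb: "adjoint (lincomb f) v = (\<chi> k. \<Sum>i\<in>UNIV. cnj (f k $ i) * v $ i)"
proof -
  have "lincomb f a \<bullet> v = a \<bullet> (\<chi> k. \<Sum>i\<in>UNIV. cnj (f k $ i) * v $ i)" for a v
  proof -
    have "lincomb f a \<bullet> v = (\<Sum>k\<in>UNIV. (a $ k *s f k) \<bullet> v)"
      by (simp add: lincomb_def inner_sum_left)
    also have "\<dots> = (\<Sum>k\<in>UNIV. \<Sum>i\<in>UNIV. a $ k \<bullet> (cnj (f k $ i) * v $ i))"
      unfolding inner_vec_def by (intro sum.cong refl) (simp add: inner_complex_def algebra_simps)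
    finally show ?thesis by (simp add: inner_vec_def inner_sum_right)
  qed
  then have "adjoint (lincomb f) = (\<lambda>v. \<chi> k. \<Sum>i\<in>UNIV. cnj (f k $ i) * v $ i)"
    by (intro adjoint_unique) simp
  then show ?thesis by (rule fun_cong)
qed

lemma sum_matrix_vector: "(\<Sum>k\<in>K. M k) *v x = (\<Sum>k\<in>K. M k *v (x :: complex^'n))"
  by (induction K rule: infinite_finite_induct) (simp_all add: matrix_vector_mult_add_rdistrib)

text \<open>A matrix times the conjugate transpose of another is the sum of the outer products of
  their columns. Summed moments thus become the operator to which
  \<open>orthonormal_basis_of_nonneg_relation\<close> applies.\<close>

lemma lincomb_adjoint: "lincomb f (adjoint (lincomb e) v) = (\<Sum>k\<in>UNIV. outer (f k) (e k)) *v v"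
proof -
  have "outer (f k) (e k) *v v = (\<Sum>j\<in>UNIV. cnj (e k $ j) * v $ j) *s f k" for k
    by (simp add: outer_def matrix_vector_mult_def vec_eq_iff sum_distrib_left sum_distrib_right mult_ac)
  then have "lincomb f (adjoint (lincomb e) v) = (\<Sum>k\<in>UNIV. outer (f k) (e k) *v v)"
    by (simp add: lincomb_def adjoint_lincomb)
  also have "\<dots> = (\<Sum>k\<in>UNIV. outer (f k) (e k)) *v v"
    by (rule sum_matrix_vector[symmetric])
  finally show ?thesis .
qed

lemma lincomb_matrix: "M *v lincomb f a = lincomb (\<lambda>k. M *v f k) a"
  by (simp add: lincomb_def matrix_vector_smult_complex linear_sum[OF matrix_vector_mul_linear])

lemma lincomb_diff: "lincomb (\<lambda>k. f k - g k) a = lincomb f a - lincomb g a"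
  by (simp add: lincomb_def vec_eq_iff sum_subtractf algebra_simps)

lemma lincomb_add: "lincomb (\<lambda>k. f k + g k) a = lincomb f a + lincomb g a"
  by (simp add: lincomb_def vec_eq_iff sum.distrib algebra_simps)

lemma lincomb_smult: "lincomb (\<lambda>k. c *s f k) a = c *s lincomb f a"
  by (simp add: lincomb_def vec_eq_iff sum_distrib_left mult_ac)

lemma lincomb_scaleR: "lincomb (\<lambda>k. c *\<^sub>R f k) a = c *\<^sub>R lincomb f a"
  by (simp add: lincomb_def vec_eq_iff scaleR_sum_right)

lemma lincomb_axis: "lincomb f (axis k c) = c *s f k"
proof -
  have "lincomb f (axis k c) = (\<Sum>j\<in>UNIV. if j = k then c *s f k else 0)"
    unfolding lincomb_def by (intro sum.cong refl) (simp add: axis_def)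
  then show ?thesis by simp
qed

text \<open>The real basis of \<open>complex^'k\<close> has two elements for each index,
  \<open>axis k 1\<close> and \<open>axis k \<i>\<close>; hence the factor 2.\<close>

lemma sum_norm_lincomb_Basis:
  "(\<Sum>b\<in>Basis. (norm (lincomb f b))\<^sup>2) = 2 * (\<Sum>k\<in>UNIV. (norm (f k))\<^sup>2)"
proof -
  have B: "(Basis :: (complex^'k) set) = (\<lambda>(k, u). axis k u) ` (UNIV \<times> {1, \<i>})"
    by (auto simp: Basis_vec_def Basis_complex_def)
  have inj: "inj_on (\<lambda>(k, u). axis k u :: complex^'k) (UNIV \<times> {1, \<i>})"
    by (auto simp: inj_on_def axis_eq_axis)
  show ?thesis
    unfolding B by (subst sum.reindex[OF inj])
      (simp add: lincomb_axis norm_vector_smult sum.cartesian_product' sum_distrib_left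
        o_def case_prod_unfold)
qed

section \<open>Moments of the frequency band\<close>

lemma outer_smult: "outer (c *s x) y = c *\<^sub>m outer x y" "outer x (c *s y) = cnj c *\<^sub>m outer x y"
  by (simp_all add: outer_def scale_mat_def vec_eq_iff mult_ac)

lemma scale_mat_diff: "c *\<^sub>m (M - N) = c *\<^sub>m M - c *\<^sub>m N"
  by (simp add: scale_mat_def vec_eq_iff algebra_simps)

lemma scale_mat_sum: "(\<Sum>k\<in>K. c *\<^sub>m M k) = c *\<^sub>m (\<Sum>k\<in>K. M k)"
  by (simp add: scale_mat_def vec_eq_iff sum_distrib_left)

lemma scale_mat_eq_0: "c \<noteq> 0 \<Longrightarrow> c *\<^sub>m M = 0 \<longleftrightarrow> M = 0"
  by (simp add: scale_mat_def vec_eq_iff)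

lemma scale_mat_zero: "c *\<^sub>m 0 = 0"
  by (simp add: scale_mat_def vec_eq_iff)

lemma scale_mat_scaleR: "c *\<^sub>m (r *\<^sub>R M) = r *\<^sub>R (c *\<^sub>m M)"
  by (simp add: scale_mat_def vec_eq_iff)

lemma hermitian_sum: "(\<And>k. k \<in> K \<Longrightarrow> hermitian (M k)) \<Longrightarrow> hermitian (\<Sum>k\<in>K. M k)"
  unfolding hermitian_def
  by (induction K rule: infinite_finite_induct) (simp_all add: ctranspose_def vec_eq_iff)

text \<open>The pairing is the squared modulus of the Hermitian product of \<open>v\<close> and
  \<open>w\<close>, obtained here from a family with a single column.\<close>

lemma outer_nonneg: "0 \<le> outer v v \<bullet> outer w w"
proof -
  let ?l = "lincomb (\<lambda>_::unit. v)"
  have "outer v v \<bullet> outer w w = w \<bullet> ?l (adjoint ?l w)"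
    by (simp add: inner_outer lincomb_adjoint UNIV_unit)
  also have "\<dots> = adjoint ?l w \<bullet> adjoint ?l w"
    by (simp add: adjoint_works[OF linear_lincomb] inner_commute)
  finally show ?thesis by simp
qed

lemma continuous_on_matrix_vector [continuous_intros]:
  "continuous_on S f \<Longrightarrow> continuous_on S (\<lambda>w. (M :: complex^'n^'m) *v f w)"
  by (rule bounded_linear.continuous_on[OF matrix_vector_mul_bounded_linear])

lemma continuous_on_vector_smult [continuous_intros]:
  "continuous_on S f \<Longrightarrow> continuous_on S (\<lambda>w. c *s (f w :: complex^'n))"
  using continuous_on_matrix_vector[of S f "mat c"] by simp

lemma continuous_on_outer [continuous_intros]:
  "continuous_on S f \<Longrightarrow> continuous_on S g \<Longrightarrow> continuous_on S (\<lambda>w. outer (f w) (g w))"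
  unfolding outer_def by (intro continuous_intros)

lemma continuous_on_scale_mat [continuous_intros]:
  "continuous_on S f \<Longrightarrow> continuous_on S (\<lambda>w. c *\<^sub>m f w)"
  unfolding scale_mat_def map_matrix_def by (intro continuous_intros)

text \<open>It vanishes exactly when \<open>outer z x\<close> is Hermitian, in particular when
  \<open>z\<close> is a real multiple of \<open>x\<close>. The factor \<open>\<i>\<close> makes it
  Hermitian.\<close>

definition moment_u :: "complex^'n \<Rightarrow> complex^'n \<Rightarrow> complex^'n^'n"
  where "moment_u x z = \<i> *\<^sub>m (outer z x - outer x z)"

text \<open>The Hermitian part of \<open>outer (z - a *\<^sub>R x) (b *\<^sub>R x - z)\<close>. At
  \<open>z = r *\<^sub>R x\<close> it is (r - a)(b - r) times \<open>outer x x\<close>.\<close>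

definition moment_v :: "real \<Rightarrow> real \<Rightarrow> complex^'n \<Rightarrow> complex^'n \<Rightarrow> complex^'n^'n"
  where "moment_v a b x z =
    ((a + b) / 2) *\<^sub>R (outer z x + outer x z) - outer z z - (a * b) *\<^sub>R outer x x"

lemma hermitian_moment_u: "hermitian (moment_u x z)"
  unfolding hermitian_def moment_u_def
  by (simp add: scale_mat_diff) (simp add: scale_mat_def vec_eq_iff)

lemma hermitian_moment_v: "hermitian (moment_v a b x z)"
  by (simp add: hermitian_def moment_v_def add.commute)

lemma moment_scaleR:
  "moment_u (r *\<^sub>R x) (r *\<^sub>R z) = r\<^sup>2 *\<^sub>R moment_u x z"
  "moment_v a b (r *\<^sub>R x) (r *\<^sub>R z) = r\<^sup>2 *\<^sub>R moment_v a b x z"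
proof -
  show "moment_u (r *\<^sub>R x) (r *\<^sub>R z) = r\<^sup>2 *\<^sub>R moment_u x z"
    by (simp add: moment_u_def outer_linear power2_eq_square flip: scale_mat_scaleR scaleR_diff_right)
  show "moment_v a b (r *\<^sub>R x) (r *\<^sub>R z) = r\<^sup>2 *\<^sub>R moment_v a b x z"
    by (simp add: moment_v_def outer_linear power2_eq_square scaleR_diff_right scaleR_add_right mult_ac)
qed

text \<open>Here \<open>\<theta>\<close> stands for j^nu and the interval from \<open>a\<close> to
  \<open>b\<close> for the values of omega^nu. The fractional order leaves no other trace.\<close>

locale finite_band =
  fixes A :: "complex^'n^'n" and B :: "complex^'u^'n" and C :: "complex^'n^'y"
    and D :: "complex^'u^'y" and \<theta> :: complex and a b \<delta> :: real
  assumes norm_theta: "cmod \<theta> = 1" and a_le_b: "a \<le> b" and delta_pos: "0 < \<delta>"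
begin

text \<open>Negative exactly when the output norm is below \<open>\<delta>\<close> times the input
  norm; the scaling by \<open>\<delta>\<close> is the one that the Schur complement of the last
  block produces.\<close>

definition perf :: "complex^'n \<Rightarrow> complex^'u \<Rightarrow> real"
  where "perf x u = (norm (C *v x + D *v u))\<^sup>2 / \<delta> - \<delta> * (norm u)\<^sup>2"

definition rot :: "complex^'n \<Rightarrow> complex^'u \<Rightarrow> complex^'n"
  where "rot x u = cnj \<theta> *s (A *v x + B *v u)"

lemma theta_cnj: "\<theta> * cnj \<theta> = 1"
  using norm_theta by (simp flip: complex_norm_square)

definition moments :: "(complex^'n) \<times> (complex^'u) \<Rightarrow> real \<times> (complex^'n^'n) \<times> (complex^'n^'n)"
  where "moments w = (perf (fst w) (snd w), moment_u (fst w) (rot (fst w) (snd w)),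
    moment_v a b (fst w) (rot (fst w) (snd w)))"

lemma moments_scaleR: "moments (r *\<^sub>R w) = r\<^sup>2 *\<^sub>R moments w"
proof -
  have "rot (r *\<^sub>R x) (r *\<^sub>R u) = r *\<^sub>R rot x u" for x u
    by (simp add: rot_def linear_scale[OF matrix_vector_mul_linear] vec_eq_iff algebra_simps)
  moreover have "perf (r *\<^sub>R x) (r *\<^sub>R u) = r\<^sup>2 * perf x u" for x u
    by (simp add: perf_def linear_scale[OF matrix_vector_mul_linear] power_mult_distrib algebra_simps
        flip: scaleR_add_right)
  ultimately show ?thesis by (simp add: moments_def moment_scaleR)
qed

lemma continuous_on_moments: "continuous_on S moments"
  unfolding moments_def perf_def rot_def moment_u_def moment_v_def
  using delta_pos by (intro continuous_intros) auto

text \<open>These triples pair nonnegatively with every multiplier (c, U, V) with c nonnegative, U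
  arbitrary and V positive semidefinite.\<close>

definition dual_cone :: "(real \<times> (complex^'n^'n) \<times> (complex^'n^'n)) set"
  where "dual_cone = {(t, M, N). 0 \<le> t \<and> M = 0 \<and> (\<forall>w. 0 \<le> N \<bullet> outer w w)}"

section \<open>Necessity: separating the moments from the dual cone\<close>

context
  assumes neg: "\<And>x u r. (x, u) \<noteq> 0 \<Longrightarrow> a \<le> r \<Longrightarrow> r \<le> b \<Longrightarrow>
        A *v x + B *v u = (\<theta> * complex_of_real r) *s x \<Longrightarrow> perf x u < 0"
begin

text \<open>With the \<open>e k\<close> and \<open>f k\<close> as columns of two matrices, the
  hypotheses make the second times the adjoint of the first Hermitian and nonnegative. The resulting
  orthonormal basis mixes the family into members on the curve, where \<open>neg\<close> applies,
  while the total performance is only doubled. Hence every mixed member is zero.\<close>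

lemma moments_imp_zero:
  fixes x :: "'k::finite \<Rightarrow> complex^'n" and u :: "'k \<Rightarrow> complex^'u"
  assumes mu: "(\<Sum>k\<in>UNIV. moment_u (x k) (rot (x k) (u k))) = 0"
    and mv: "\<And>w. 0 \<le> (\<Sum>k\<in>UNIV. moment_v a b (x k) (rot (x k) (u k))) \<bullet> outer w w"
    and mp: "0 \<le> (\<Sum>k\<in>UNIV. perf (x k) (u k))"
  shows "x k = 0 \<and> u k = 0"
proof -
  define z where "z k = rot (x k) (u k)" for k
  define e where "e k = b *\<^sub>R x k - z k" for k
  define f where "f k = z k - a *\<^sub>R x k" for k
  have swap: "(\<Sum>k\<in>UNIV. outer (z k) (x k) - outer (x k) (z k)) = 0"
    using mu by (simp only: moment_u_def scale_mat_sum scale_mat_eq_0[OF complex_i_not_zero] z_def)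
  \<comment> \<open>The skew-Hermitian remainder is a multiple of the difference that
    \<open>swap\<close> sums to zero.\<close>
  have "outer (f k) (e k) = moment_v a b (x k) (z k)
      + ((b - a) / 2) *\<^sub>R (outer (z k) (x k) - outer (x k) (z k))" for k
    by (simp add: e_def f_def moment_v_def outer_linear vec_eq_iff)
      (simp add: scaleR_conv_of_real field_simps)
  then have R: "(\<Sum>k\<in>UNIV. outer (f k) (e k)) = (\<Sum>k\<in>UNIV. moment_v a b (x k) (z k))"
    by (simp only: sum.distrib swap flip: scaleR_sum_right) simp
  obtain Q where Q: "finite Q" "pairwise orthogonal Q" "span Q = UNIV" "\<And>q. q \<in> Q \<Longrightarrow> norm q = 1"
    "\<And>q. q \<in> Q \<Longrightarrow> lincomb f q = 0 \<or> (\<exists>c\<ge>0. lincomb e q = c *\<^sub>R lincomb f q)"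
  proof (rule orthonormal_basis_of_nonneg_relation[of "lincomb e" "lincomb f"])
    show "lincomb f (adjoint (lincomb e) v) \<bullet> w = v \<bullet> lincomb f (adjoint (lincomb e) w)" for v w
      unfolding lincomb_adjoint R
      by (intro hermitian_inner hermitian_sum hermitian_moment_v)
    show "0 \<le> lincomb f (adjoint (lincomb e) v) \<bullet> v" for v
      unfolding lincomb_adjoint R
      by (subst inner_commute) (use mv[of v] in \<open>simp add: inner_outer z_def\<close>)
  qed (auto intro: linear_lincomb)
  have curve: "perf (lincomb x q) (lincomb u q) < 0" if q: "q \<in> Q" "(lincomb x q, lincomb u q) \<noteq> 0" for q
  proof -
    have zq: "lincomb z q = cnj \<theta> *s (A *v lincomb x q + B *v lincomb u q)"
      unfolding z_def rot_def lincomb_smult lincomb_add lincomb_matrix ..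
    then have Az: "A *v lincomb x q + B *v lincomb u q = \<theta> *s lincomb z q"
      by (simp add: vector_smult_assoc theta_cnj)
    have eq: "lincomb e q = b *\<^sub>R lincomb x q - lincomb z q"
      "lincomb f q = lincomb z q - a *\<^sub>R lincomb x q"
      unfolding e_def f_def by (simp_all add: lincomb_diff lincomb_scaleR)
    have "\<exists>r. a \<le> r \<and> r \<le> b \<and> lincomb z q = r *\<^sub>R lincomb x q"
      using Q(5)[OF q(1)]
    proof
      \<comment> \<open>This is the endpoint \<open>r = a\<close>, where no finite \<open>c\<close>
        would describe the relation unless \<open>x\<close> also vanishes or the endpoints
        agree.\<close>
      assume "lincomb f q = 0"
      then show ?thesis using a_le_b eq by (intro exI[of _ a]) auto
    next
      assume "\<exists>c\<ge>0. lincomb e q = c *\<^sub>R lincomb f q"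
      then obtain c where c: "c \<ge> 0" "lincomb e q = c *\<^sub>R lincomb f q" by auto
      \<comment> \<open>Solving for \<open>z\<close> gives \<open>r = (b + c * a) / (1 + c)\<close>,
        a convex combination of \<open>a\<close> and \<open>b\<close>.\<close>
      then have "(1 + c) *\<^sub>R lincomb z q = (b + c * a) *\<^sub>R lincomb x q"
        unfolding eq by (simp add: algebra_simps)
      then have "(1 / (1 + c)) *\<^sub>R ((1 + c) *\<^sub>R lincomb z q)
          = (1 / (1 + c)) *\<^sub>R ((b + c * a) *\<^sub>R lincomb x q)" by simp
      then have "lincomb z q = ((b + c * a) / (1 + c)) *\<^sub>R lincomb x q"
        using c(1) by simp
      moreover have "a \<le> (b + c * a) / (1 + c)" "(b + c * a) / (1 + c) \<le> b"
        using c(1) a_le_b mult_left_mono[OF a_le_b c(1)] by (simp_all add: field_simps)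
      ultimately show ?thesis by blast
    qed
    then obtain r where r: "a \<le> r" "r \<le> b" "lincomb z q = r *\<^sub>R lincomb x q" by auto
    have "A *v lincomb x q + B *v lincomb u q = (\<theta> * complex_of_real r) *s lincomb x q"
      unfolding Az r(3) by (simp add: vector_smult_assoc flip: of_real_vector_smult)
    from neg[OF q(2) r(1,2) this] show ?thesis .
  qed
  let ?g = "\<lambda>k. C *v x k + D *v u k"
  \<comment> \<open>\<open>perf\<close> is a difference of squared norms of linear images, so its
    sum is the same over every real orthonormal basis.\<close>
  have "(\<Sum>q\<in>Q. perf (lincomb x q) (lincomb u q))
      = (\<Sum>q\<in>Q. (norm (lincomb ?g q))\<^sup>2) / \<delta> - \<delta> * (\<Sum>q\<in>Q. (norm (lincomb u q))\<^sup>2)"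
    by (simp add: perf_def lincomb_add lincomb_matrix sum_subtractf sum_distrib_left sum_divide_distrib)
  also have "\<dots> = 2 * (\<Sum>k\<in>UNIV. perf (x k) (u k))"
    by (simp add: sum_norm_orthonormal_invariant[OF linear_lincomb Q(1-4)] sum_norm_lincomb_Basis
        perf_def sum_subtractf sum_distrib_left sum_divide_distrib algebra_simps)
  finally have nn: "0 \<le> (\<Sum>q\<in>Q. perf (lincomb x q) (lincomb u q))" using mp by simp
  have zero: "(lincomb x q, lincomb u q) = 0" if q: "q \<in> Q" for q
  proof (rule ccontr)
    assume nz: "(lincomb x q, lincomb u q) \<noteq> 0"
    have "(\<Sum>q\<in>Q. perf (lincomb x q) (lincomb u q)) < (\<Sum>q\<in>Q. 0)"
    proof (rule sum_strict_mono_ex1)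
      have "perf (lincomb x q) (lincomb u q) \<le> 0" if "q \<in> Q" for q
        using curve[OF that] by (cases "(lincomb x q, lincomb u q) = 0") (auto simp: perf_def zero_prod_def)
      then show "\<forall>q\<in>Q. perf (lincomb x q) (lincomb u q) \<le> 0" by blast
      show "\<exists>q\<in>Q. perf (lincomb x q) (lincomb u q) < 0" using curve[OF q nz] q by blast
    qed (rule Q(1))
    then show False using nn by simp
  qed
  have "lincomb x q = 0" "lincomb u q = 0" for q
    using linear_eq_0_on_span[OF linear_lincomb, of Q x q]
      linear_eq_0_on_span[OF linear_lincomb, of Q u q] zero Q(3)
    by (auto simp: zero_prod_def)
  from this[of "axis k 1"] show ?thesis by (simp add: lincomb_axis)
qed

text \<open>The moments are quadratic, so the weights of a convex combination are absorbed into the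
  vectors as square roots. A common point would give a family that \<open>moments_imp_zero\<close>
  annihilates, although its weights sum to 1.\<close>

lemma convex_hull_moments_disjoint: "convex hull (moments ` sphere 0 1) \<inter> dual_cone = {}"
proof (rule ccontr)
  assume "convex hull (moments ` sphere 0 1) \<inter> dual_cone \<noteq> {}"
  then obtain y where y: "y \<in> convex hull (moments ` sphere 0 1)" "y \<in> dual_cone" by auto
  \<comment> \<open>With n = \<open>CARD('n)\<close>, the real dimension is 4 n^2 + 1 and the index
    type has 8 n^2 elements, enough for the 4 n^2 + 2 points of Caratheodory.\<close>
  have "DIM(real \<times> (complex^'n^'n) \<times> (complex^'n^'n)) + 1 \<le> CARD(bool \<times> bool \<times> bool \<times> 'n \<times> 'n)"
  proof -
    have "0 < CARD('n) * CARD('n)" by simp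
    then show ?thesis by simp
  qed
  then obtain p :: "bool \<times> bool \<times> bool \<times> 'n \<times> 'n \<Rightarrow> real" and v
    where p: "\<And>k. 0 \<le> p k" "\<And>k. v k \<in> moments ` sphere 0 1" "sum p UNIV = 1"
      "(\<Sum>k\<in>UNIV. p k *\<^sub>R v k) = y"
    using convex_hull_indexed[OF y(1)] by blast
  obtain w where w: "\<And>k. norm (w k) = 1" "\<And>k. v k = moments (w k)"
    using p(2) unfolding image_iff by (metis dist_0_norm mem_sphere)
  define s where "s k = sqrt (p k) *\<^sub>R w k" for k
  have "moments (s k) = p k *\<^sub>R v k" for k
    using p(1) by (simp add: s_def w(2) moments_scaleR)
  then have "(\<Sum>k\<in>UNIV. moments (s k)) = y" using p(4) by simp
  then have m: "0 \<le> fst (\<Sum>k\<in>UNIV. moments (s k))" "fst (snd (\<Sum>k\<in>UNIV. moments (s k))) = 0"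
    "\<And>w. 0 \<le> snd (snd (\<Sum>k\<in>UNIV. moments (s k))) \<bullet> outer w w"
    using y(2) by (auto simp: dual_cone_def)
  have "fst (s k) = 0 \<and> snd (s k) = 0" for k
    using m by (intro moments_imp_zero) (simp_all add: fst_sum snd_sum moments_def)
  then have "s k = 0" for k by (simp add: prod_eq_iff)
  moreover have "norm (s k) = sqrt (p k)" for k
    using w(1) p(1) by (simp add: s_def)
  ultimately have "p k = 0" for k by (metis norm_zero real_sqrt_eq_zero_cancel_iff)
  then show False using p(3) by simp
qed

text \<open>Strict separation of a compact hull from a closed cone gives multipliers that are only
  semidefinite. The gap leaves room for a small perturbation making the weight of
  \<open>perf\<close> positive and V definite; dividing by that weight normalises it to 1.\<close>

lemma separating_matrices:
  "\<exists>U V. hermitian U \<and> pos_definite V \<and>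
     (\<forall>x u. (x, u) \<noteq> 0 \<longrightarrow>
        U \<bullet> moment_u x (rot x u) + V \<bullet> moment_v a b x (rot x u) + perf x u < 0)"
proof -
  let ?S = "moments ` (sphere 0 1 :: ((complex^'n) \<times> (complex^'u)) set)"
  have comp: "compact ?S"
    by (intro compact_continuous_image continuous_on_moments compact_sphere)
  have dc: "dual_cone = {y. 0 \<le> fst y} \<inter> {y. fst (snd y) = 0} \<inter> (\<Inter>w. {y. 0 \<le> snd (snd y) \<bullet> outer w w})"
    by (auto simp: dual_cone_def)
  have "closed dual_cone"
    unfolding dc
    by (intro closed_Int closed_INT closed_Collect_le closed_Collect_eq continuous_intros ballI)
  moreover have "convex dual_cone"
    by (rule convexI) (auto simp: dual_cone_def inner_add_left)
  moreover have "convex hull ?S \<noteq> {}" by simp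
  ultimately obtain d \<beta> where d: "\<And>y. y \<in> convex hull ?S \<Longrightarrow> d \<bullet> y < \<beta>" "\<And>y. y \<in> dual_cone \<Longrightarrow> \<beta> < d \<bullet> y"
    using separating_hyperplane_compact_closed[OF convex_convex_hull compact_convex_hull[OF comp] _ _ _
        convex_hull_moments_disjoint]
    by blast
  obtain c U0 V0 where dd: "d = (c, U0, V0)" by (cases d) auto
  have "0 \<in> dual_cone" by (simp add: dual_cone_def zero_prod_def)
  from d(2)[OF this] have \<beta>: "\<beta> < 0" by simp
  \<comment> \<open>A functional bounded below on a ray is nonnegative there: otherwise the multiple
    \<open>\<beta> / (d \<bullet> y)\<close> of \<open>y\<close> would attain the excluded value
    \<open>\<beta>\<close>.\<close>
  have cone: "0 \<le> d \<bullet> y" if "\<And>t. 0 \<le> t \<Longrightarrow> t *\<^sub>R y \<in> dual_cone" for y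
  proof (rule ccontr)
    assume n: "\<not> 0 \<le> d \<bullet> y"
    then have "0 \<le> \<beta> / (d \<bullet> y)" using \<beta> by (simp add: divide_nonpos_neg)
    from d(2)[OF that[OF this]] n show False by simp
  qed
  have c: "0 \<le> c"
    using cone[of "(1, 0, 0)"] by (simp add: dual_cone_def dd)
  have V0: "0 \<le> V0 \<bullet> outer v v" for v
    using cone[of "(0, 0, outer v v)"] by (simp add: dual_cone_def dd outer_nonneg)
  obtain m where m: "\<And>y. y \<in> ?S \<Longrightarrow> norm y \<le> m" "0 < m"
    using compact_imp_bounded[OF comp] unfolding bounded_pos by metis
  define h where "h = (1 :: real, 0 :: complex^'n^'n, mat 1 :: complex^'n^'n)"
  \<comment> \<open>By Cauchy-Schwarz this perturbation changes the functional on the moments by at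
    most the gap \<open>- \<beta>\<close>.\<close>
  define \<epsilon> where "\<epsilon> = - \<beta> / (m * norm h)"
  have "norm h > 0" by (simp add: h_def zero_prod_def)
  then have \<epsilon>: "0 < \<epsilon>" "\<epsilon> * (norm h * m) = - \<beta>"
    using m(2) \<beta> by (simp_all add: \<epsilon>_def divide_neg_pos)
  have lt: "(d + \<epsilon> *\<^sub>R h) \<bullet> y < 0" if "y \<in> ?S" for y
  proof -
    have "h \<bullet> y \<le> norm h * norm y" by (rule norm_cauchy_schwarz)
    also have "\<dots> \<le> norm h * m" using m(1)[OF that] by (intro mult_left_mono) auto
    finally have "\<epsilon> * (h \<bullet> y) \<le> - \<beta>" using \<epsilon> by (metis mult_left_mono less_imp_le)
    moreover have "d \<bullet> y < \<beta>" using that by (intro d(1) hull_inc)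
    ultimately show ?thesis by (simp add: inner_add_left)
  qed
  define c' where "c' = c + \<epsilon>"
  have c': "0 < c'" using c \<epsilon>(1) by (simp add: c'_def)
  define U where "U = (1 / c') *\<^sub>R herm_part U0"
  define V where "V = (1 / c') *\<^sub>R herm_part (V0 + \<epsilon> *\<^sub>R mat 1)"
  have herm: "hermitian U" "hermitian V"
    using hermitian_herm_part[of U0] hermitian_herm_part[of "V0 + \<epsilon> *\<^sub>R mat 1"]
    by (simp_all add: U_def V_def hermitian_def)
  have UM: "U \<bullet> M = (U0 \<bullet> M) / c'" and VM: "V \<bullet> M = (V0 \<bullet> M + \<epsilon> * (mat 1 \<bullet> M)) / c'"
    if "hermitian M" for M
    using inner_herm_part[OF that] by (simp_all add: U_def V_def inner_add_left)
  have "pos_definite V"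
    unfolding pos_definite_def Re_quad_form
  proof (intro conjI allI impI herm)
    fix x :: "complex^'n" assume "x \<noteq> 0"
    then have "0 < \<epsilon> * (x \<bullet> x)" using \<epsilon> by simp
    then have "0 < (V0 \<bullet> outer x x + \<epsilon> * (mat 1 \<bullet> outer x x)) / c'"
      using V0[of x] c' by (simp add: inner_outer[of "mat 1"])
    also have "\<dots> = V \<bullet> outer x x" by (rule VM[symmetric]) (simp add: hermitian_def)
    finally show "0 < x \<bullet> (V *v x)" by (simp add: inner_outer)
  qed
  moreover have "U \<bullet> moment_u x (rot x u) + V \<bullet> moment_v a b x (rot x u) + perf x u < 0"
    if "(x, u) \<noteq> 0" for x u
  proof -
    define n where "n = norm (x, u)"
    have n: "n > 0" using that by (simp add: n_def)
    have "(x, u) = n *\<^sub>R ((1 / n) *\<^sub>R (x, u))" using n by simp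
    then have "moments (x, u) = n\<^sup>2 *\<^sub>R moments ((1 / n) *\<^sub>R (x, u))"
      by (metis moments_scaleR)
    moreover have "(1 / n) *\<^sub>R (x, u) \<in> sphere 0 1"
      unfolding mem_sphere_0 norm_scaleR n_def[symmetric] using n by simp
    ultimately have "(d + \<epsilon> *\<^sub>R h) \<bullet> moments (x, u) < 0"
      using lt[of "moments ((1 / n) *\<^sub>R (x, u))"] n by (simp add: mult_less_0_iff)
    then have "c' * perf x u + U0 \<bullet> moment_u x (rot x u)
        + (V0 \<bullet> moment_v a b x (rot x u) + \<epsilon> * (mat 1 \<bullet> moment_v a b x (rot x u))) < 0"
      by (simp add: dd h_def moments_def c'_def inner_add_left algebra_simps)
    then have "(c' * perf x u + U0 \<bullet> moment_u x (rot x u)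
        + (V0 \<bullet> moment_v a b x (rot x u) + \<epsilon> * (mat 1 \<bullet> moment_v a b x (rot x u)))) / c' < 0"
      using c' by (simp add: divide_neg_pos)
    then show ?thesis
      using c' by (simp add: UM[OF hermitian_moment_u] VM[OF hermitian_moment_v] add_divide_distrib)
  qed
  ultimately show ?thesis using herm by blast
qed

end

text \<open>Compactness of the unit sphere turns strict negativity into a uniform margin, from which
  come both invertibility of the pencil and strictness of the bound on the supremum.\<close>

lemma strict_on_curve:
  assumes U: "hermitian U" and V: "pos_definite V"
    and lmi: "\<And>x u. (x, u) \<noteq> 0 \<Longrightarrow>
      U \<bullet> moment_u x (rot x u) + V \<bullet> moment_v a b x (rot x u) + perf x u < 0"
  obtains \<epsilon> where "0 < \<epsilon>"
    "\<And>x u r. a \<le> r \<Longrightarrow> r \<le> b \<Longrightarrow> A *v x + B *v u = (\<theta> * complex_of_real r) *s x \<Longrightarrow>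
      perf x u \<le> - \<epsilon> * (norm (x, u))\<^sup>2"
proof -
  let ?f = "\<lambda>w. (1, U, V) \<bullet> moments w"
  have fxu: "?f (x, u) = U \<bullet> moment_u x (rot x u) + V \<bullet> moment_v a b x (rot x u) + perf x u" for x u
    by (simp add: moments_def)
  have "\<exists>w\<in>sphere 0 1. \<forall>v\<in>sphere 0 1. ?f v \<le> ?f w"
    by (intro continuous_attains_sup compact_sphere continuous_intros continuous_on_moments) auto
  then obtain w where w: "norm w = 1" "\<And>v. norm v = 1 \<Longrightarrow> ?f v \<le> ?f w" by auto
  have "w \<noteq> 0" using w(1) by auto
  then have neg: "?f w < 0" using lmi[of "fst w" "snd w"] fxu[of "fst w" "snd w"] by simp
  have le: "?f v \<le> ?f w * (norm v)\<^sup>2" for v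
  proof (cases "v = 0")
    case True
    then show ?thesis using moments_scaleR[of 0 v] by simp
  next
    case False
    have "moments ((1 / norm v) *\<^sub>R v) = (1 / (norm v)\<^sup>2) *\<^sub>R moments v"
      unfolding moments_scaleR by (simp add: power_divide)
    with w(2)[of "(1 / norm v) *\<^sub>R v"] False show ?thesis
      by (simp add: divide_le_eq)
  qed
  show ?thesis
  proof (rule that[of "- ?f w"])
    fix x u r
    assume r: "a \<le> r" "r \<le> b" and curve: "A *v x + B *v u = (\<theta> * complex_of_real r) *s x"
    \<comment> \<open>On the curve the rotated vector is a real multiple of \<open>x\<close>, so the
      U-part drops out and the V-part is nonnegative.\<close>
    have z: "rot x u = r *\<^sub>R x"
      unfolding rot_def curve using theta_cnj
      by (simp add: vector_smult_assoc mult_ac flip: of_real_vector_smult)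
    have "U \<bullet> moment_u x (rot x u) = 0"
      unfolding moment_u_def z by (simp add: outer_linear scale_mat_zero)
    moreover have "V \<bullet> moment_v a b x (rot x u) = ((r - a) * (b - r)) * (x \<bullet> (V *v x))"
      unfolding moment_v_def z
      by (simp only: outer_linear inner_add_right inner_diff_right inner_scaleR_right inner_outer)
        (simp add: field_simps)
    moreover have "0 \<le> x \<bullet> (V *v x)"
      using V by (cases "x = 0") (auto simp: pos_definite_def Re_quad_form less_imp_le)
    ultimately have "perf x u \<le> ?f (x, u)"
      using r by (simp add: fxu)
    also have "\<dots> \<le> ?f w * (norm (x, u))\<^sup>2" by (rule le)
    finally show "perf x u \<le> - (- ?f w) * (norm (x, u))\<^sup>2" by simp
  qed (use neg in simp)
qed

end

section \<open>Singular values and block matrices\<close>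

lemma inner_gram: "((ctranspose M ** M) *v x) \<bullet> y = (M *v x) \<bullet> (M *v y)"
  by (metis inner_commute inner_ctranspose matrix_vector_mul_assoc)

lemma gram_symmetric: "((ctranspose M ** M) *v x) \<bullet> y = x \<bullet> ((ctranspose M ** M) *v y)"
  by (metis inner_commute inner_gram)

text \<open>Eigenvectors for distinct singular values are orthogonal, hence independent. Finiteness
  is what gives \<open>Max\<close> in \<open>sigma_max\<close> its meaning.\<close>

lemma finite_singular_values: "finite (singular_values M)"
proof -
  let ?G = "ctranspose M ** M"
  have "\<forall>s\<in>singular_values M. \<exists>v. v \<noteq> 0 \<and> ?G *v v = s\<^sup>2 *\<^sub>R v"
    unfolding singular_values_def of_real_vector_smult by blast
  then obtain v where v: "\<And>s. s \<in> singular_values M \<Longrightarrow> v s \<noteq> 0 \<and> ?G *v v s = s\<^sup>2 *\<^sub>R v s"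
    by metis
  have orth: "v s \<bullet> v t = 0" if "s \<in> singular_values M" "t \<in> singular_values M" "s \<noteq> t" for s t
  proof -
    have "(?G *v v s) \<bullet> v t = v s \<bullet> (?G *v v t)"
      by (rule gram_symmetric)
    then have "(s\<^sup>2 - t\<^sup>2) * (v s \<bullet> v t) = 0" using v that by (simp add: algebra_simps)
    moreover have "s\<^sup>2 \<noteq> t\<^sup>2" using that by (simp add: singular_values_def)
    ultimately show ?thesis by simp
  qed
  have "inj_on v (singular_values M)"
    using orth v by (intro inj_onI) (metis inner_eq_zero_iff)
  moreover have "finite (v ` singular_values M)"
  proof (intro independent_imp_finite pairwise_orthogonal_independent)
    show "pairwise orthogonal (v ` singular_values M)"
      using orth by (auto simp: pairwise_def orthogonal_def)
  qed (use v in auto)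
  ultimately show ?thesis by (rule finite_imageD[rotated])
qed

lemma norm_singular_vector:
  assumes "(ctranspose M ** M) *v v = complex_of_real (\<sigma>\<^sup>2) *s v" "0 \<le> \<sigma>"
  shows "norm (M *v v) = \<sigma> * norm v"
proof -
  have "(M *v v) \<bullet> (M *v v) = \<sigma>\<^sup>2 * (v \<bullet> v)"
    unfolding inner_gram[symmetric] assms(1) of_real_vector_smult by (rule inner_scaleR_left)
  then have "(norm (M *v v))\<^sup>2 = (\<sigma> * norm v)\<^sup>2"
    by (simp only: power2_norm_eq_inner power_mult_distrib)
  then show ?thesis using assms(2) by (simp add: power2_eq_iff_nonneg)
qed

text \<open>The square root of the largest eigenvalue of the Gram matrix is a singular value and
  bounds the operator norm.\<close>

lemma top_singular_value:
  obtains \<sigma> where "\<sigma> \<in> singular_values M" "\<And>v. norm (M *v v) \<le> \<sigma> * norm v"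
proof -
  let ?G = "ctranspose M ** M"
  obtain x c where x: "norm x = 1" "?G *v x = c *\<^sub>R x" "\<And>y. (?G *v y) \<bullet> y \<le> c * (y \<bullet> y)"
  proof (rule symmetric_max_eigenvector[of "(*v) ?G" UNIV])
    show "(UNIV :: (complex^'a) set) \<noteq> {0}"
      by (rule UNIV_not_singleton)
    show "(?G *v x) \<bullet> y = x \<bullet> (?G *v y)" for x y
      by (rule gram_symmetric)
  qed (auto intro: matrix_vector_mul_linear)
  have "c = (M *v x) \<bullet> (M *v x)"
    unfolding inner_gram[symmetric] x(2) using x(1) by (simp add: norm_eq_1)
  then have c: "0 \<le> c" by simp
  show ?thesis
  proof (rule that[of "sqrt c"])
    show "sqrt c \<in> singular_values M"
      using x(1,2) c unfolding singular_values_def of_real_vector_smult mem_Collect_eq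
      by (intro conjI exI[of _ x]) auto
    show "norm (M *v v) \<le> sqrt c * norm v" for v
    proof (rule power2_le_imp_le)
      show "(norm (M *v v))\<^sup>2 \<le> (sqrt c * norm v)\<^sup>2"
        using x(3)[of v] c by (simp add: power_mult_distrib power2_norm_eq_inner inner_gram)
    qed (use c in simp)
  qed
qed

lemma norm_le_sigma_max: "norm (M *v v) \<le> sigma_max M * norm v"
proof -
  obtain \<sigma> where \<sigma>: "\<sigma> \<in> singular_values M" "\<And>v. norm (M *v v) \<le> \<sigma> * norm v"
    using top_singular_value[of M] by blast
  have "\<sigma> \<le> sigma_max M"
    unfolding sigma_max_def by (rule Max_ge[OF finite_singular_values \<sigma>(1)])
  then show ?thesis using \<sigma>(2)[of v] by (meson mult_right_mono norm_ge_zero order_trans)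
qed

lemma sigma_max_le:
  assumes "\<And>v. norm (M *v v) \<le> c * norm v"
  shows "sigma_max M \<le> c"
  unfolding sigma_max_def
proof (subst Max_le_iff[OF finite_singular_values])
  show "singular_values M \<noteq> {}" using top_singular_value[of M] by blast
  show "\<forall>\<sigma>\<in>singular_values M. \<sigma> \<le> c"
  proof
    fix \<sigma> assume "\<sigma> \<in> singular_values M"
    then obtain v where v: "0 \<le> \<sigma>" "v \<noteq> 0" "(ctranspose M ** M) *v v = complex_of_real (\<sigma>\<^sup>2) *s v"
      by (auto simp: singular_values_def)
    have "\<sigma> * norm v \<le> c * norm v"
      using assms[of v] norm_singular_vector[OF v(3,1)] by simp
    then show "\<sigma> \<le> c" using v(2) by simp
  qed
qed

section \<open>Block vectors, block matrices and the Schur complement\<close>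

definition join3 :: "complex^'n \<Rightarrow> complex^'u \<Rightarrow> complex^'y \<Rightarrow> complex^('n + 'u + 'y)"
  where "join3 x u y = (\<chi> i. case i of Inl a \<Rightarrow> x $ a | Inr (Inl b) \<Rightarrow> u $ b | Inr (Inr c) \<Rightarrow> y $ c)"

lemma join3_cases: obtains x u y where "p = join3 x u y"
proof
  show "p = join3 (\<chi> a. p $ Inl a) (\<chi> b. p $ Inr (Inl b)) (\<chi> c. p $ Inr (Inr c))"
    by (auto simp: join3_def vec_eq_iff split: sum.split)
qed

lemma join3_eq_0: "join3 x u y = 0 \<longleftrightarrow> x = 0 \<and> u = 0 \<and> y = 0"
proof
  assume *: "join3 x u y = 0"
  have "x $ a = 0" "u $ b = 0" "y $ c = 0" for a b c
    using arg_cong[OF *, of "\<lambda>p. p $ Inl a"] arg_cong[OF *, of "\<lambda>p. p $ Inr (Inl b)"]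
      arg_cong[OF *, of "\<lambda>p. p $ Inr (Inr c)"]
    by (simp_all add: join3_def)
  then show "x = 0 \<and> u = 0 \<and> y = 0" by (simp add: vec_eq_iff)
qed (auto simp: join3_def vec_eq_iff split: sum.split)

lemma sum_UNIV_Plus:
  "(\<Sum>i\<in>(UNIV :: ('a::finite + 'b::finite) set). f i) = (\<Sum>a\<in>UNIV. f (Inl a)) + (\<Sum>b\<in>UNIV. f (Inr b))"
  by (simp add: sum.Plus flip: UNIV_Plus_UNIV)

lemma inner_join3: "join3 x u y \<bullet> join3 x' u' y' = x \<bullet> x' + u \<bullet> u' + y \<bullet> y'"
  by (simp add: inner_vec_def join3_def sum_UNIV_Plus)

lemma block3_join3:
  "block3 P Q R S T E F H K *v join3 x u y =
    join3 (P *v x + Q *v u + R *v y) (S *v x + T *v u + E *v y) (F *v x + H *v u + K *v y)"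
  by (auto simp: block3_def join3_def vec_eq_iff matrix_vector_mult_def sum_UNIV_Plus split: sum.split)

lemma ctranspose_block3:
  "ctranspose (block3 P Q R S T E F H K) =
    block3 (ctranspose P) (ctranspose S) (ctranspose F) (ctranspose Q) (ctranspose T) (ctranspose H)
      (ctranspose R) (ctranspose E) (ctranspose K)"
  by (auto simp: block3_def ctranspose_def vec_eq_iff split: sum.split)

lemma norm_pair_ge_snd: "(norm u)\<^sup>2 \<le> (norm (x, u))\<^sup>2"
  by (simp add: norm_Pair)

text \<open>For fixed \<open>x\<close> and \<open>u\<close> the expression is concave in
  \<open>y\<close> with its maximum at \<open>(1 / \<delta>) *\<^sub>R g x u\<close>; completing the
  square eliminates \<open>y\<close>.\<close>

lemma schur_complement:
  fixes g :: "'a::real_inner \<Rightarrow> 'b::real_inner \<Rightarrow> 'c::real_inner"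
  assumes \<delta>: "0 < \<delta>" and g0: "g 0 0 = 0" and L0: "L 0 0 = 0"
  shows "(\<forall>x u y. \<not> (x = 0 \<and> u = 0 \<and> y = 0) \<longrightarrow> L x u + 2 * (g x u \<bullet> y) - \<delta> * (y \<bullet> y) < (0::real)) \<longleftrightarrow>
    (\<forall>x u. (x, u) \<noteq> 0 \<longrightarrow> L x u + (norm (g x u))\<^sup>2 / \<delta> < 0)"
proof (intro iffI allI impI)
  fix x :: 'a and u :: 'b
  assume *: "\<forall>x u y. \<not> (x = 0 \<and> u = 0 \<and> y = 0) \<longrightarrow> L x u + 2 * (g x u \<bullet> y) - \<delta> * (y \<bullet> y) < 0"
    and nz: "(x, u) \<noteq> 0"
  have "\<not> (x = 0 \<and> u = 0 \<and> (1 / \<delta>) *\<^sub>R g x u = 0)"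
    using nz by (auto simp: zero_prod_def)
  from *[rule_format, OF this] show "L x u + (norm (g x u))\<^sup>2 / \<delta> < 0"
    using \<delta> by (simp add: power2_norm_eq_inner)
next
  fix x :: 'a and u :: 'b and y :: 'c
  assume *: "\<forall>x u. (x, u) \<noteq> 0 \<longrightarrow> L x u + (norm (g x u))\<^sup>2 / \<delta> < 0"
    and nz: "\<not> (x = 0 \<and> u = 0 \<and> y = 0)"
  show "L x u + 2 * (g x u \<bullet> y) - \<delta> * (y \<bullet> y) < 0"
  proof (cases "(x, u) = 0")
    case True
    then show ?thesis using nz \<delta> by (simp add: zero_prod_def g0 L0)
  next
    case False
    have "0 \<le> (1 / \<delta>) * ((g x u - \<delta> *\<^sub>R y) \<bullet> (g x u - \<delta> *\<^sub>R y))" using \<delta> by simp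
    also have "\<dots> = (norm (g x u))\<^sup>2 / \<delta> - 2 * (g x u \<bullet> y) + \<delta> * (y \<bullet> y)"
      using \<delta> by (simp add: inner_diff_left inner_diff_right power2_norm_eq_inner inner_commute field_simps)
    finally show ?thesis using * False by (smt (verit))
  qed
qed

lemma inner_moment_u: "hermitian U \<Longrightarrow> U \<bullet> moment_u x z = 2 * ((\<i> *s z) \<bullet> (U *v x))"
proof -
  assume U: "hermitian U"
  have "U \<bullet> moment_u x z = (\<i> *s z) \<bullet> (U *v x) - (\<i> *s x) \<bullet> (U *v z)"
    by (simp add: moment_u_def scale_mat_diff inner_diff_right inner_outer flip: outer_smult)
  moreover have "(\<i> *s x) \<bullet> (U *v z) = z \<bullet> (\<i> *s (U *v x))"
    using hermitian_inner[OF U, of "\<i> *s x" z] unfolding matrix_vector_smult_complex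
    by (metis inner_commute)
  moreover have "z \<bullet> (\<i> *s (U *v x)) = - ((\<i> *s z) \<bullet> (U *v x))"
  proof -
    have "cnj \<i> *s z = - (\<i> *s z)" by (simp add: vec_eq_iff)
    then show ?thesis by (simp add: inner_vector_smult)
  qed
  ultimately show ?thesis by simp
qed

lemma inner_moment_v:
  "hermitian V \<Longrightarrow>
    V \<bullet> moment_v a b x z = (a + b) * (z \<bullet> (V *v x)) - z \<bullet> (V *v z) - a * b * (x \<bullet> (V *v x))"
proof -
  assume "hermitian V"
  then have "x \<bullet> (V *v z) = z \<bullet> (V *v x)" by (metis hermitian_inner inner_commute)
  then show ?thesis
    by (simp add: moment_v_def inner_diff_right inner_add_right inner_outer field_simps)
qed

section \<open>The matrix inequality as a quadratic form\<close>

context finite_band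
begin

text \<open>Rotating \<open>z\<close> by the conjugate of \<open>\<theta>\<close> absorbs the phase
  of \<open>W\<close>, and it leaves the form of \<open>V\<close> at \<open>z\<close> unchanged
  because \<open>\<theta>\<close> has modulus 1.\<close>

lemma lmi_inner:
  assumes U: "hermitian U" and V: "hermitian V"
    and W: "W = (- \<i> * \<theta>) *\<^sub>m U + (\<theta> * complex_of_real ((a + b) / 2)) *\<^sub>m V"
    and z: "z = A *v x + B *v u"
  shows "2 * (z \<bullet> (W *v x)) - z \<bullet> (V *v z) - a * b * (x \<bullet> (V *v x))
    = U \<bullet> moment_u x (rot x u) + V \<bullet> moment_v a b x (rot x u)"
proof -
  have rot: "rot x u = cnj \<theta> *s z" by (simp add: rot_def z)
  have "z \<bullet> (W *v x) = z \<bullet> ((- \<i> * \<theta>) *s (U *v x)) + z \<bullet> (\<theta> *s (((a + b) / 2) *\<^sub>R (V *v x)))"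
    unfolding W matrix_vector_mult_add_rdistrib scale_mat_vector inner_add_right
    by (metis of_real_vector_smult vector_smult_assoc)
  also have "z \<bullet> ((- \<i> * \<theta>) *s (U *v x)) = (\<i> *s rot x u) \<bullet> (U *v x)"
    unfolding inner_vector_smult rot by (simp add: vector_smult_assoc)
  also have "z \<bullet> (\<theta> *s (((a + b) / 2) *\<^sub>R (V *v x))) = ((a + b) / 2) * (rot x u \<bullet> (V *v x))"
    unfolding inner_vector_smult[of z \<theta>] rot by simp
  finally have zW: "2 * (z \<bullet> (W *v x)) = 2 * ((\<i> *s rot x u) \<bullet> (U *v x)) + (a + b) * (rot x u \<bullet> (V *v x))"
    by simp
  have "rot x u \<bullet> (V *v rot x u) = z \<bullet> (V *v z)"
    unfolding rot matrix_vector_smult_complex inner_vector_smult[of _ "cnj \<theta>"]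
    by (simp add: vector_smult_assoc theta_cnj)
  with zW show ?thesis
    by (simp add: inner_moment_u[OF U] inner_moment_v[OF V])
qed

text \<open>On \<open>join3 x u y\<close> the leading blocks assemble into the form of
  \<open>lmi_inner\<close> at \<open>z = A *v x + B *v u\<close>; the last block row is then removed
  by \<open>schur_complement\<close>.\<close>

lemma neg_definite_block3_iff:
  assumes U: "hermitian U" and V: "hermitian V"
    and W: "W = (- \<i> * \<theta>) *\<^sub>m U + (\<theta> * complex_of_real ((a + b) / 2)) *\<^sub>m V"
    and Y: "Y = - (ctranspose B ** V ** A) + ctranspose B ** W"
  shows "neg_definite (block3
      (Sym (ctranspose A ** W) - ctranspose A ** V ** A - complex_of_real (a * b) *\<^sub>m V)
      (ctranspose Y) (ctranspose C)
      Y (- mat (complex_of_real \<delta>) - ctranspose B ** V ** B) (ctranspose D)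
      C D (- mat (complex_of_real \<delta>))) \<longleftrightarrow>
    (\<forall>x u. (x, u) \<noteq> 0 \<longrightarrow>
      U \<bullet> moment_u x (rot x u) + V \<bullet> moment_v a b x (rot x u) + perf x u < 0)"
    (is "neg_definite ?M \<longleftrightarrow> ?R")
proof -
  have V': "ctranspose V = V" using V by (simp add: hermitian_def)
  have herm: "hermitian ?M"
    by (simp add: hermitian_def ctranspose_block3 Sym_def V' matrix_mul_assoc add.commute)
  have adj: "x \<bullet> (ctranspose N *v y) = (N *v x) \<bullet> y" for N :: "complex^'i^'j" and x y
    by (simp add: inner_ctranspose)
  define L where "L x u = U \<bullet> moment_u x (rot x u) + V \<bullet> moment_v a b x (rot x u) - \<delta> * (u \<bullet> u)" for x u
  have form: "join3 x u y \<bullet> (?M *v join3 x u y)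
      = L x u + 2 * ((C *v x + D *v u) \<bullet> y) - \<delta> * (y \<bullet> y)" for x u y
  proof -
    define z where "z = A *v x + B *v u"
    have Yx: "u \<bullet> (Y *v x) = (B *v u) \<bullet> (W *v x) - (B *v u) \<bullet> (V *v (A *v x))"
      unfolding Y by (simp add: matrix_vector_mult_diff_rdistrib inner_diff_right adj
          flip: matrix_vector_mul_assoc)
    have S: "x \<bullet> (Sym (ctranspose A ** W) *v x) = 2 * ((A *v x) \<bullet> (W *v x))"
      by (simp add: Sym_def matrix_vector_mult_add_rdistrib inner_add_right adj
          inner_commute[of "W *v x"] flip: matrix_vector_mul_assoc)
    have zz: "2 * (z \<bullet> (W *v x)) - z \<bullet> (V *v z) = 2 * ((A *v x) \<bullet> (W *v x)) - (A *v x) \<bullet> (V *v (A *v x))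
        - (B *v u) \<bullet> (V *v (B *v u)) + 2 * ((B *v u) \<bullet> (W *v x)) - 2 * ((B *v u) \<bullet> (V *v (A *v x)))"
    proof -
      have "(A *v x) \<bullet> (V *v (B *v u)) = (B *v u) \<bullet> (V *v (A *v x))"
        by (metis V hermitian_inner inner_commute)
      then show ?thesis
        by (simp add: z_def matrix_vector_right_distrib inner_add_left inner_add_right)
    qed
    have d: "y \<bullet> (D *v u) = (D *v u) \<bullet> y" "y \<bullet> (C *v x) = (C *v x) \<bullet> y"
      by (simp_all add: inner_commute)
    have Yt: "x \<bullet> (ctranspose Y *v u) = u \<bullet> (Y *v x)" by (simp add: adj inner_commute)
    have PQ: "x \<bullet> ((Sym (ctranspose A ** W) - ctranspose A ** V ** A - complex_of_real (a * b) *\<^sub>m V) *v x)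
        = 2 * ((A *v x) \<bullet> (W *v x)) - (A *v x) \<bullet> (V *v (A *v x)) - a * b * (x \<bullet> (V *v x))"
      unfolding matrix_vector_mult_diff_rdistrib inner_diff_right S scale_mat_vector of_real_vector_smult
      by (simp add: adj flip: matrix_vector_mul_assoc)
    have T: "u \<bullet> ((- mat (complex_of_real \<delta>) - ctranspose B ** V ** B) *v u)
        = - \<delta> * (u \<bullet> u) - (B *v u) \<bullet> (V *v (B *v u))"
      by (simp add: matrix_vector_mult_diff_rdistrib inner_diff_right of_real_vector_smult adj
          flip: matrix_vector_mul_assoc)
    have K: "y \<bullet> ((- mat (complex_of_real \<delta>)) *v y) = - \<delta> * (y \<bullet> y)"
      by (simp add: of_real_vector_smult)
    show ?thesis
      unfolding block3_join3 inner_join3 inner_add_right PQ T K Yt Yx L_def adj d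
        lmi_inner[OF U V W z_def, symmetric] inner_add_left
      using zz Yx by (simp add: inner_commute[of "Y *v x" u])
  qed
  have all: "(\<forall>p. P p) \<longleftrightarrow> (\<forall>x u y. P (join3 x u y))" for P :: "complex^('n + 'u + 'y) \<Rightarrow> bool"
    by (metis join3_cases)
  have "neg_definite ?M \<longleftrightarrow> (\<forall>x u y. \<not> (x = 0 \<and> u = 0 \<and> y = 0) \<longrightarrow>
      L x u + 2 * ((C *v x + D *v u) \<bullet> y) - \<delta> * (y \<bullet> y) < 0)"
    unfolding neg_definite_def Re_quad_form all form join3_eq_0 using herm by simp
  also have "\<dots> \<longleftrightarrow> (\<forall>x u. (x, u) \<noteq> 0 \<longrightarrow> L x u + (norm (C *v x + D *v u))\<^sup>2 / \<delta> < 0)"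
  proof (rule schur_complement[OF delta_pos])
    have "rot 0 0 = 0" by (simp add: rot_def)
    moreover have "moment_u (0 :: complex^'n) 0 = 0" "moment_v a b (0 :: complex^'n) 0 = 0"
      by (simp_all add: moment_u_def moment_v_def outer_def scale_mat_def vec_eq_iff)
    ultimately show "L 0 0 = 0" by (simp add: L_def)
  qed simp
  also have "\<dots> \<longleftrightarrow> ?R"
    by (simp add: L_def perf_def power2_norm_eq_inner algebra_simps)
  finally show ?thesis .
qed

end

section \<open>The bounded real lemma on a frequency band\<close>

lemma pencil_vector: "pencil \<nu> A s *v x = (s powr complex_of_real \<nu>) *s x - cmat A *v x"
  by (simp add: pencil_def matrix_vector_mult_diff_rdistrib)

text \<open>For positive \<open>\<omega>\<close> the principal logarithm splits without a branch
  change; at 0 both sides are 0 because \<open>0 powr a = 0\<close>.\<close>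

lemma imaginary_powr:
  assumes "0 \<le> \<omega>"
  shows "(\<i> * complex_of_real \<omega>) powr complex_of_real \<nu> = \<i> powr complex_of_real \<nu> * complex_of_real (\<omega> powr \<nu>)"
proof (cases "\<omega> = 0")
  case False
  with assms have "0 < \<omega>" by simp
  then show ?thesis
    using Ln_times_of_real[of \<omega> \<i>]
    by (simp add: powr_def mult.commute[of \<i>] distrib_left exp_add Ln_of_real
        flip: of_real_mult exp_of_real)
qed simp

lemma i_powr: "\<i> powr complex_of_real \<nu> = exp (\<i> * complex_of_real (pi / 2 * \<nu>))"
  by (simp add: powr_def mult_ac)

lemma invertible_solution:
  fixes P :: "complex^'n^'n"
  assumes "invertible P"
  shows "P *v x = y \<longleftrightarrow> x = matrix_inv P *v y"
proof -
  have "P ** matrix_inv P = mat 1" "matrix_inv P ** P = mat 1"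
    using someI_ex[OF assms[unfolded invertible_def]] by (simp_all add: matrix_inv_def)
  then show ?thesis
    by (metis matrix_vector_mul_assoc matrix_vector_mul_lid)
qed

text \<open>The left side demands an invertible pencil on the band because \<open>transfer\<close>
  is meaningful only there; a singular pencil counts as a failure of the bound.\<close>

theorem theorem25:
  fixes \<nu> \<delta> \<omega>\<^sub>1 \<omega>\<^sub>2 \<phi> :: real
    and \<omega>\<^sub>c :: complex
    and A :: "real^'n^'n" and B :: "real^'u^'n" and C :: "real^'n^'y" and D :: "real^'u^'y"
  assumes "0 < \<nu>" and "\<nu> < 2"
    and "0 \<le> \<omega>\<^sub>1" and "\<omega>\<^sub>1 \<le> \<omega>\<^sub>2"
    and "\<delta> > 0"
    and "\<phi> = pi / 2 * (\<nu> - 1)"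
    and "\<omega>\<^sub>c = \<i> powr complex_of_real \<nu> * complex_of_real ((\<omega>\<^sub>1 powr \<nu> + \<omega>\<^sub>2 powr \<nu>) / 2)"
  shows "((\<forall>\<omega>\<in>freq_band \<omega>\<^sub>1 \<omega>\<^sub>2. invertible (pencil \<nu> A (\<i> * complex_of_real \<omega>))) \<and>
          Linf_norm (freq_band \<omega>\<^sub>1 \<omega>\<^sub>2) (transfer \<nu> A B C D) < ereal \<delta>)
     \<longleftrightarrow>
         (\<exists>U V :: complex^'n^'n. hermitian U \<and> hermitian V \<and> pos_definite V \<and>
            (let W = exp (\<i> * complex_of_real \<phi>) *\<^sub>m U + \<omega>\<^sub>c *\<^sub>m V;
                 X = cmat (transpose A) ** W;
                 Y = - (cmat (transpose B) ** V ** cmat A) + cmat (transpose B) ** W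
             in neg_definite
                  (block3
                    (Sym X - cmat (transpose A) ** V ** cmat A
                       - complex_of_real (\<omega>\<^sub>1 powr \<nu> * \<omega>\<^sub>2 powr \<nu>) *\<^sub>m V)
                    (ctranspose Y)
                    (cmat (transpose C))
                    Y
                    (- mat (complex_of_real \<delta>) - cmat (transpose B) ** V ** cmat B)
                    (cmat (transpose D))
                    (cmat C)
                    (cmat D)
                    (- mat (complex_of_real \<delta>)))))"
    (is "?L \<longleftrightarrow> ?R")
proof -
  define \<theta> where "\<theta> = \<i> powr complex_of_real \<nu>"
  let ?a = "\<omega>\<^sub>1 powr \<nu>" and ?b = "\<omega>\<^sub>2 powr \<nu>"
  let ?A = "cmat A" and ?B = "cmat B" and ?C = "cmat C" and ?D = "cmat D"
  let ?P = "\<lambda>\<omega>. pencil \<nu> A (\<i> * complex_of_real \<omega>)"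
  let ?G = "\<lambda>\<omega>. transfer \<nu> A B C D (\<i> * complex_of_real \<omega>)"
  interpret finite_band ?A ?B ?C ?D \<theta> ?a ?b \<delta>
  proof
    show "cmod \<theta> = 1" by (simp add: \<theta>_def i_powr norm_exp_i_times del: of_real_mult)
    show "?a \<le> ?b" using assms(1,3,4) by (intro powr_mono2) auto
  qed (rule assms)
  let ?lmi = "\<lambda>U V. \<forall>x u. (x, u) \<noteq> 0 \<longrightarrow>
      U \<bullet> moment_u x (rot x u) + V \<bullet> moment_v ?a ?b x (rot x u) + perf x u < 0"
  \<comment> \<open>The angle \<open>\<phi>\<close> is the angle of \<open>\<theta>\<close> less a
    quarter turn.\<close>
  have exp_\<phi>: "exp (\<i> * complex_of_real \<phi>) = - \<i> * \<theta>"
  proof -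
    have "\<i> * complex_of_real \<phi> = \<i> * complex_of_real (pi / 2 * \<nu>) - \<i> * complex_of_real (pi / 2)"
      unfolding assms(6) by (simp add: field_simps)
    moreover have "exp (\<i> * complex_of_real (pi / 2)) = \<i>"
      by (simp add: cis_conv_exp[symmetric] del: of_real_divide)
    ultimately show ?thesis
      unfolding \<theta>_def i_powr by (simp add: exp_diff del: of_real_divide of_real_mult)
  qed
  have R: "?R \<longleftrightarrow> (\<exists>U V. hermitian U \<and> pos_definite V \<and> ?lmi U V)"
  proof -
    have *: "neg_definite
                  (block3
                    (Sym (cmat (transpose A) ** W) - cmat (transpose A) ** V ** cmat A
                       - complex_of_real (\<omega>\<^sub>1 powr \<nu> * \<omega>\<^sub>2 powr \<nu>) *\<^sub>m V)
                    (ctranspose Y)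
                    (cmat (transpose C))
                    Y
                    (- mat (complex_of_real \<delta>) - cmat (transpose B) ** V ** cmat B)
                    (cmat (transpose D))
                    (cmat C)
                    (cmat D)
                    (- mat (complex_of_real \<delta>))) \<longleftrightarrow> ?lmi U V"
      if "hermitian U" "hermitian V" "W = exp (\<i> * complex_of_real \<phi>) *\<^sub>m U + \<omega>\<^sub>c *\<^sub>m V"
        "Y = - (cmat (transpose B) ** V ** cmat A) + cmat (transpose B) ** W" for U V W Y
      using neg_definite_block3_iff[of U V W Y] that
      unfolding exp_\<phi> assms(7) \<theta>_def[symmetric] ctranspose_cmat by blast
    show ?thesis
      unfolding Let_def
      using * by (metis (no_types, lifting) pos_definite_def)
  qed
  have band: "\<omega> \<in> freq_band \<omega>\<^sub>1 \<omega>\<^sub>2 \<Longrightarrow>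
      ?a \<le> \<omega> powr \<nu> \<and> \<omega> powr \<nu> \<le> ?b \<and>
      (\<i> * complex_of_real \<omega>) powr complex_of_real \<nu> = \<theta> * complex_of_real (\<omega> powr \<nu>)" for \<omega>
    using assms(1,3) by (auto simp: freq_band_def imaginary_powr \<theta>_def intro!: powr_mono2)
  have transfer: "?G \<omega> *v u = ?C *v (matrix_inv (?P \<omega>) *v (?B *v u)) + ?D *v u" for \<omega> u
    by (simp add: transfer_def matrix_vector_mult_add_rdistrib matrix_vector_mul_assoc matrix_mul_assoc)
  show ?thesis
    unfolding R
  proof
    assume L: ?L
    have "perf x u < 0"
      if nz: "(x, u) \<noteq> 0" and r: "?a \<le> r" "r \<le> ?b"
        and curve: "?A *v x + ?B *v u = (\<theta> * complex_of_real r) *s x" for x u r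
    proof -
      have r0: "0 \<le> r" using r(1) powr_ge_zero[of \<omega>\<^sub>1 \<nu>] by linarith
      \<comment> \<open>The frequency whose power is \<open>r\<close>; monotonicity of the root
        places it in the band.\<close>
      define \<omega> where "\<omega> = r powr (1 / \<nu>)"
      have r\<omega>: "r = \<omega> powr \<nu>" using r0 assms(1) by (simp add: \<omega>_def powr_powr)
      have "\<omega>\<^sub>1 = ?a powr (1 / \<nu>)" "\<omega>\<^sub>2 = ?b powr (1 / \<nu>)"
        using assms(1,3,4) by (simp_all add: powr_powr)
      moreover have "?a powr (1 / \<nu>) \<le> \<omega>" "\<omega> \<le> ?b powr (1 / \<nu>)"
        unfolding \<omega>_def using r r0 assms(1) by (auto intro!: powr_mono2)
      ultimately have \<omega>: "\<omega> \<in> freq_band \<omega>\<^sub>1 \<omega>\<^sub>2"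
        unfolding freq_band_def by (simp add: \<omega>_def)
      then have inv: "invertible (?P \<omega>)" using L by blast
      have "?P \<omega> *v x = ?B *v u"
        using band[OF \<omega>] curve by (simp add: pencil_vector r\<omega> algebra_simps)
      then have x: "x = matrix_inv (?P \<omega>) *v (?B *v u)" using invertible_solution[OF inv] by blast
      \<comment> \<open>A zero input would force \<open>x = 0\<close> through the invertible
        pencil.\<close>
      have "u \<noteq> 0" using x nz by (auto simp: zero_prod_def)
      have "ereal (sigma_max (?G \<omega>)) \<le> Linf_norm (freq_band \<omega>\<^sub>1 \<omega>\<^sub>2) (transfer \<nu> A B C D)"
        unfolding Linf_norm_def by (rule SUP_upper[OF \<omega>])
      then have "sigma_max (?G \<omega>) < \<delta>" using L by (metis ereal_less_eq(3) less_ereal.simps(1) order_le_less_trans)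
      then have "norm (?G \<omega> *v u) < \<delta> * norm u"
        using norm_le_sigma_max[of "?G \<omega>" u] \<open>u \<noteq> 0\<close>
        by (meson mult_strict_right_mono order_le_less_trans zero_less_norm_iff)
      then have "(norm (?C *v x + ?D *v u))\<^sup>2 < (\<delta> * norm u)\<^sup>2"
        unfolding transfer x[symmetric] by (intro power_strict_mono) auto
      then show ?thesis
        using assms(5) by (simp add: perf_def power_mult_distrib power2_eq_square field_simps)
    qed
    then show "\<exists>U V. hermitian U \<and> pos_definite V \<and> ?lmi U V"
      by (rule separating_matrices)
  next
    assume "\<exists>U V. hermitian U \<and> pos_definite V \<and> ?lmi U V"
    then obtain U V where "hermitian U" "pos_definite V" "?lmi U V" by blast
    then obtain \<epsilon> where \<epsilon>: "0 < \<epsilon>"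
      "\<And>x u r. ?a \<le> r \<Longrightarrow> r \<le> ?b \<Longrightarrow> ?A *v x + ?B *v u = (\<theta> * complex_of_real r) *s x \<Longrightarrow>
        perf x u \<le> - \<epsilon> * (norm (x, u))\<^sup>2"
      using strict_on_curve[of U V] by blast
    have on_band: "perf x u \<le> - \<epsilon> * (norm (x, u))\<^sup>2"
      if "\<omega> \<in> freq_band \<omega>\<^sub>1 \<omega>\<^sub>2" "?P \<omega> *v x = ?B *v u" for \<omega> x u
      using that band[OF that(1)] by (intro \<epsilon>(2)[of "\<omega> powr \<nu>"]) (auto simp: pencil_vector algebra_simps)
    have inv: "invertible (?P \<omega>)" if \<omega>: "\<omega> \<in> freq_band \<omega>\<^sub>1 \<omega>\<^sub>2" for \<omega>
      unfolding invertible_left_inverse matrix_left_invertible_ker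
    proof (intro allI impI)
      fix x assume "?P \<omega> *v x = 0"
      \<comment> \<open>A kernel vector of the pencil lies on the curve with zero input, where
        \<open>perf\<close> cannot be negative.\<close>
      then have "perf x 0 \<le> - \<epsilon> * (norm x)\<^sup>2"
        using on_band[OF \<omega>, of x 0] by (simp add: norm_Pair)
      moreover have "0 \<le> perf x 0" using assms(5) by (simp add: perf_def)
      ultimately have "\<epsilon> * (norm x)\<^sup>2 \<le> 0" by linarith
      then show "x = 0" using \<epsilon>(1) by (simp add: mult_le_0_iff)
    qed
    \<comment> \<open>The margin bounds the squared gain by
      \<open>\<delta> * (\<delta> - \<epsilon>)\<close>; \<open>max\<close> covers a margin larger
      than \<open>\<delta>\<close>. One constant below \<open>\<delta>\<close> for the whole band
      keeps the supremum strictly below \<open>\<delta>\<close>.\<close>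
    define c where "c = sqrt (\<delta> * max 0 (\<delta> - \<epsilon>))"
    have "sigma_max (?G \<omega>) \<le> c" if \<omega>: "\<omega> \<in> freq_band \<omega>\<^sub>1 \<omega>\<^sub>2" for \<omega>
    proof (rule sigma_max_le)
      fix u
      define x where "x = matrix_inv (?P \<omega>) *v (?B *v u)"
      have "?P \<omega> *v x = ?B *v u" using invertible_solution[OF inv[OF \<omega>]] x_def by blast
      then have "perf x u \<le> - \<epsilon> * (norm (x, u))\<^sup>2" by (rule on_band[OF \<omega>])
      also have "\<dots> \<le> - \<epsilon> * (norm u)\<^sup>2"
        using norm_pair_ge_snd[of u x] \<epsilon>(1) by simp
      finally have "(norm (?G \<omega> *v u))\<^sup>2 / \<delta> \<le> (\<delta> - \<epsilon>) * (norm u)\<^sup>2"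
        by (simp add: perf_def transfer x_def algebra_simps)
      also have "\<dots> \<le> max 0 (\<delta> - \<epsilon>) * (norm u)\<^sup>2" by (intro mult_right_mono) auto
      finally have "(norm (?G \<omega> *v u))\<^sup>2 \<le> (c * norm u)\<^sup>2"
        using assms(5) by (simp add: c_def power_mult_distrib divide_le_eq mult_ac)
      then show "norm (?G \<omega> *v u) \<le> c * norm u"
        by (rule power2_le_imp_le) (use assms(5) in \<open>simp add: c_def\<close>)
    qed
    then have "Linf_norm (freq_band \<omega>\<^sub>1 \<omega>\<^sub>2) (transfer \<nu> A B C D) \<le> ereal c"
      unfolding Linf_norm_def by (intro SUP_least) simp
    also have "c < \<delta>"
      unfolding c_def
    proof (rule real_less_lsqrt)
      show "\<delta> * max 0 (\<delta> - \<epsilon>) < \<delta>\<^sup>2" using assms(5) \<epsilon>(1) by (simp add: power2_eq_square)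
    qed (use assms(5) in auto)
    then have "ereal c < ereal \<delta>" by simp
    finally show ?L using inv by blast
  qed
qed

end
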